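(* Let $\Gamma=(V,E)$ be a layered graph with unique minimal vertex $*$. Then $\operatorname{gr}A(\Gamma)\cong T(V_+)/R_{gr}$, where $R_{gr}$ is the two-sided ideal of $T(V_+)$ generated by all elements $v_0v_1\cdots v_n-w_0w_1\cdots w_n$ with $(v_0,\dots,v_n)$ and $(w_0,\dots,w_n)$ vertex paths consisting of vertices of $V_+$ and with $v_0=w_0$.
   Context: A layered graph is a finite directed graph $\Gamma=(V,E)$ with $V=\bigsqcup_{i=0}^{N}V_i$ such that every edge from $V_i$ goes to $V_{i-1}$; $|v|=i$ for $v\in V_i$, $V_+=\bigsqcup_{i\ge1}V_i$, every vertex of $V_+$ has at least one outgoing edge, and $V_0=\{*\}$. A vertex path is a sequence $(v_0,\dots,v_n)$ with $(v_{j},v_{j+1})\in E$ for all $j$. The universal labeling algebra $A(\Gamma)$ is $T(E)/R$, where $T(E)$ is the free algebra over a field $\mathbb F$ and $R$ is generated by the differences of the coefficients of $(t-e_1)\cdots(t-e_m)$ and $(t-f_1)\cdots(t-f_m)$ ($t$ central) over all pairs of edge paths with the same start and same end; equivalently $A(\Gamma)\cong T(V_+)/R_V$ via $(v,w)\mapsto v-w$ ($w\ne *$), $(v,* )\mapsto v$. $\operatorname{gr}A(\Gamma)$ denotes the associated graded algebra of $A(\Gamma)=T(V_+)/R_V$ with respect to the vertex filtration, in which the image of a monomial $v_1\cdots v_j$ has filtration degree $\sum_k|v_k|$. *)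

theory Defs
  imports Main
begin

definition layered_graph :: "'v set \<Rightarrow> ('v \<times> 'v) set \<Rightarrow> ('v \<Rightarrow> nat) \<Rightarrow> 'v \<Rightarrow> bool" where
  "layered_graph V E lvl star \<longleftrightarrow>
     finite V \<and> E \<subseteq> V \<times> V \<and> star \<in> V \<and>
     (\<forall>v\<in>V. lvl v = 0 \<longleftrightarrow> v = star) \<and>
     (\<forall>(v,w)\<in>E. lvl v = Suc (lvl w)) \<and>
     (\<forall>v\<in>V. lvl v \<ge> 1 \<longrightarrow> (\<exists>w. (v,w) \<in> E))"

definition Vplus :: "'v set \<Rightarrow> 'v \<Rightarrow> 'v set" where
  "Vplus V star = {v\<in>V. v \<noteq> star}"

definition vpath :: "'v set \<Rightarrow> ('v \<times> 'v) set \<Rightarrow> 'v list \<Rightarrow> bool" where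
  "vpath V E p \<longleftrightarrow> p \<noteq> [] \<and> set p \<subseteq> V \<and> (\<forall>i. Suc i < length p \<longrightarrow> (p!i, p!Suc i) \<in> E)"

text \<open>Elements of T(X): finitely supported functions from words (lists) over X to the field.\<close>
definition Tc :: "'v set \<Rightarrow> ('v list \<Rightarrow> 'k::field) set" where
  "Tc X = {f. finite {w. f w \<noteq> 0} \<and> (\<forall>w. f w \<noteq> 0 \<longrightarrow> set w \<subseteq> X)}"

definition tzero :: "'v list \<Rightarrow> 'k::field" where "tzero = (\<lambda>w. 0)"
definition tone :: "'v list \<Rightarrow> 'k::field" where "tone = (\<lambda>w. if w = [] then 1 else 0)"
definition tmon :: "'v list \<Rightarrow> 'v list \<Rightarrow> 'k::field" where "tmon u = (\<lambda>w. if w = u then 1 else 0)"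
definition tadd :: "('v list \<Rightarrow> 'k::field) \<Rightarrow> ('v list \<Rightarrow> 'k) \<Rightarrow> 'v list \<Rightarrow> 'k" where
  "tadd f g = (\<lambda>w. f w + g w)"
definition tsub :: "('v list \<Rightarrow> 'k::field) \<Rightarrow> ('v list \<Rightarrow> 'k) \<Rightarrow> 'v list \<Rightarrow> 'k" where
  "tsub f g = (\<lambda>w. f w - g w)"
definition tsmul :: "'k::field \<Rightarrow> ('v list \<Rightarrow> 'k) \<Rightarrow> 'v list \<Rightarrow> 'k" where
  "tsmul c f = (\<lambda>w. c * f w)"
definition tmul :: "('v list \<Rightarrow> 'k::field) \<Rightarrow> ('v list \<Rightarrow> 'k) \<Rightarrow> 'v list \<Rightarrow> 'k" where
  "tmul f g = (\<lambda>w. \<Sum>i\<le>length w. f (take i w) * g (drop i w))"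

inductive_set ideal_gen :: "'v set \<Rightarrow> ('v list \<Rightarrow> 'k::field) set \<Rightarrow> ('v list \<Rightarrow> 'k) set"
  for X S where
  zero: "tzero \<in> ideal_gen X S"
| gen: "s \<in> S \<Longrightarrow> s \<in> ideal_gen X S"
| add: "x \<in> ideal_gen X S \<Longrightarrow> y \<in> ideal_gen X S \<Longrightarrow> tadd x y \<in> ideal_gen X S"
| mult: "x \<in> ideal_gen X S \<Longrightarrow> a \<in> Tc X \<Longrightarrow> b \<in> Tc X \<Longrightarrow> tmul (tmul a x) b \<in> ideal_gen X S"

definition vimg :: "'v \<Rightarrow> 'v \<Rightarrow> 'v list \<Rightarrow> 'k::field" where
  "vimg star u = (if u = star then tzero else tmon [u])"

definition eimg :: "'v \<Rightarrow> 'v \<times> 'v \<Rightarrow> 'v list \<Rightarrow> 'k::field" where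
  "eimg star e = tsub (vimg star (fst e)) (vimg star (snd e))"

text \<open>coefs [e_1,...,e_m] j = coefficient of t^j in (t - e_1)...(t - e_m), t central.\<close>
fun coefs :: "('v list \<Rightarrow> 'k::field) list \<Rightarrow> nat \<Rightarrow> 'v list \<Rightarrow> 'k" where
  "coefs [] j = (if j = 0 then tone else tzero)"
| "coefs (e # es) j = tsub (if j = 0 then tzero else coefs es (j - 1)) (tmul e (coefs es j))"

definition epath :: "'v list \<Rightarrow> ('v \<times> 'v) list" where
  "epath p = zip p (tl p)"

definition RV_gens :: "'v set \<Rightarrow> ('v \<times> 'v) set \<Rightarrow> 'v \<Rightarrow> ('v list \<Rightarrow> 'k::field) set" where
  "RV_gens V E star =
     {tsub (coefs (map (eimg star) (epath p)) j) (coefs (map (eimg star) (epath q)) j) | p q j.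
        vpath V E p \<and> vpath V E q \<and> length p = length q \<and> hd p = hd q \<and> last p = last q}"

definition RV :: "'v set \<Rightarrow> ('v \<times> 'v) set \<Rightarrow> 'v \<Rightarrow> ('v list \<Rightarrow> 'k::field) set" where
  "RV V E star = ideal_gen (Vplus V star) (RV_gens V E star)"

definition Rgr_gens :: "'v set \<Rightarrow> ('v \<times> 'v) set \<Rightarrow> 'v \<Rightarrow> ('v list \<Rightarrow> 'k::field) set" where
  "Rgr_gens V E star =
     {tsub (tmon p) (tmon q) | p q.
        vpath (Vplus V star) E p \<and> vpath (Vplus V star) E q \<and> length p = length q \<and> hd p = hd q}"

definition Rgr :: "'v set \<Rightarrow> ('v \<times> 'v) set \<Rightarrow> 'v \<Rightarrow> ('v list \<Rightarrow> 'k::field) set" where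
  "Rgr V E star = ideal_gen (Vplus V star) (Rgr_gens V E star)"

definition wdeg :: "('v \<Rightarrow> nat) \<Rightarrow> 'v list \<Rightarrow> nat" where
  "wdeg lvl w = sum_list (map lvl w)"

definition Tle :: "'v set \<Rightarrow> ('v \<Rightarrow> nat) \<Rightarrow> 'v \<Rightarrow> nat \<Rightarrow> ('v list \<Rightarrow> 'k::field) set" where
  "Tle V lvl star d = {x \<in> Tc (Vplus V star). \<forall>w. x w \<noteq> 0 \<longrightarrow> wdeg lvl w \<le> d}"
definition Tlt :: "'v set \<Rightarrow> ('v \<Rightarrow> nat) \<Rightarrow> 'v \<Rightarrow> nat \<Rightarrow> ('v list \<Rightarrow> 'k::field) set" where
  "Tlt V lvl star d = {x \<in> Tc (Vplus V star). \<forall>w. x w \<noteq> 0 \<longrightarrow> wdeg lvl w < d}"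

text \<open>Element of A(Gamma) represented by x: the coset x + R_V.\<close>
definition Acls :: "'v set \<Rightarrow> ('v \<times> 'v) set \<Rightarrow> 'v \<Rightarrow> ('v list \<Rightarrow> 'k::field) \<Rightarrow> ('v list \<Rightarrow> 'k) set" where
  "Acls V E star x = {y \<in> Tc (Vplus V star). tsub y x \<in> RV V E star}"

definition Fle where "Fle V E lvl star d = Acls V E star ` Tle V lvl star d"
definition Flt where "Flt V E lvl star d = Acls V E star ` Tlt V lvl star d"

text \<open>For x in Tle d: the class of (x + R_V) in F_d / F_(d-1), as a coset (set of elements of A).\<close>
definition grcls :: "'v set \<Rightarrow> ('v \<times> 'v) set \<Rightarrow> ('v \<Rightarrow> nat) \<Rightarrow> 'v \<Rightarrow> nat \<Rightarrow> ('v list \<Rightarrow> 'k::field)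
     \<Rightarrow> ('v list \<Rightarrow> 'k) set set" where
  "grcls V E lvl star d x =
     {Acls V E star y | y. y \<in> Tle V lvl star d \<and>
        (\<exists>z \<in> Tlt V lvl star d. tsub (tsub y x) z \<in> RV V E star)}"

definition gr_comp where "gr_comp V E lvl star d = grcls V E lvl star d ` Tle V lvl star d"

definition grrep where
  "grrep V E lvl star d X = (SOME x. x \<in> Tle V lvl star d \<and> X = grcls V E lvl star d x)"

text \<open>gr A = direct sum of the components, as finitely supported families.\<close>
definition grA where
  "grA V E lvl star = {g. (\<forall>d. g d \<in> gr_comp V E lvl star d) \<and>
                            finite {d. g d \<noteq> grcls V E lvl star d tzero}}"

definition gzero where "gzero V E lvl star = (\<lambda>d. grcls V E lvl star d tzero)"
definition gone where "gone V E lvl star = (\<lambda>d. grcls V E lvl star d (if d = 0 then tone else tzero))"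
definition gadd where
  "gadd V E lvl star g h = (\<lambda>d. grcls V E lvl star d
      (tadd (grrep V E lvl star d (g d)) (grrep V E lvl star d (h d))))"
definition gsmul where
  "gsmul V E lvl star c g = (\<lambda>d. grcls V E lvl star d (tsmul c (grrep V E lvl star d (g d))))"
definition gmul where
  "gmul V E lvl star g h = (\<lambda>d. grcls V E lvl star d
      (\<lambda>w. \<Sum>i\<le>d. tmul (grrep V E lvl star i (g i)) (grrep V E lvl star (d - i) (h (d - i))) w))"

end

theory Submission
  imports Defs "HOL-Library.Function_Algebras"
begin

text \<open>
  The isomorphism sends \<open>x\<close> to the family of classes of its homogeneous components, and the whole content
  is that the leading forms of \<open>R\<^sub>V\<close> span exactly \<open>R\<^sub>g\<^sub>r\<close>.

  Let \<open>e(v, i)\<close> be the elementary symmetric function of the edges on a path from \<open>v\<close> to \<open>*\<close>; in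
  \<open>A(\<Gamma>)\<close> it does not depend on the path. Its leading form is the product of the first \<open>i\<close> vertices of
  the path, so every generator of \<open>R\<^sub>g\<^sub>r\<close> is the leading form of an element of \<open>R\<^sub>V\<close>.

  For the converse we build a right \<open>A(\<Gamma>)\<close>-module whose basis are lists of blocks \<open>(b, k)\<close>, a block
  standing for \<open>e(b, k)\<close>. With \<open>E\<^sub>v(s) = \<Sum>\<^sub>i e(v, i) s\<^sup>i\<close> and \<open>H\<^sub>v = E\<^sub>v\<^sup>-\<^sup>1\<close>, the relations of \<open>A(\<Gamma>)\<close> say
  \<open>H\<^sub>w = H\<^sub>v (1 + s (v - w))\<close> for every edge \<open>v \<rightarrow> w\<close>. They imply that \<open>E\<^sub>b H\<^sub>u\<close> is a polynomial in \<open>s\<close> of degree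
  at most \<open>k\<close> whenever \<open>u\<close> is reached from \<open>b\<close> in \<open>k\<close> steps, and reading this as a recursion for the
  action of \<open>H\<^sub>u\<close> on a list ending in the block \<open>(b, k)\<close> defines the module. A comparison of degrees
  in \<open>s\<close> shows that the relations do hold. To leading order a word acts on the empty list by
  producing the normal form of its class in the monoid with relations \<open>R\<^sub>g\<^sub>r\<close>; hence an element of
  \<open>R\<^sub>V\<close>, which acts by zero, has its leading form in \<open>R\<^sub>g\<^sub>r\<close>.
\<close>

section \<open>The free algebra\<close>

lemma tadd_eq_plus: "tadd f g = f + g"
  by (auto simp: tadd_def fun_eq_iff)

lemma tsub_eq_minus: "tsub f g = f - g"
  by (auto simp: tsub_def fun_eq_iff)

lemma tzero_eq_zero: "tzero = 0"
  by (auto simp: tzero_def fun_eq_iff)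

lemmas t_arith = tadd_eq_plus tsub_eq_minus tzero_eq_zero

lemma sum_fun_apply: "(\<Sum>i\<in>I. F i) w = (\<Sum>i\<in>I. F i w)"
  by (induction I rule: infinite_finite_induct) auto

lemma tsmul_apply [simp]: "tsmul c f w = c * f w"
  by (simp add: tsmul_def)

lemma tmul_Nil: "tmul f g [] = f [] * g []"
  by (simp add: tmul_def)

lemma tmul_Cons: "tmul f g (a # w) = f [] * g (a # w) + tmul (\<lambda>u. f (a # u)) g w"
  unfolding tmul_def
  by (simp only: list.size add_Suc_right add_0_right sum.atMost_Suc_shift take_0 drop_0 take_Suc_Cons drop_Suc_Cons)

lemma tmul_add_left: "tmul (f + f') g = tmul f g + tmul f' g"
  by (auto simp: tmul_def fun_eq_iff sum.distrib algebra_simps)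

lemma tmul_add_right: "tmul f (g + g') = tmul f g + tmul f g'"
  by (auto simp: tmul_def fun_eq_iff sum.distrib algebra_simps)

lemma tmul_diff_left: "tmul (f - f') g = tmul f g - tmul f' g"
  by (auto simp: tmul_def fun_eq_iff sum_subtractf algebra_simps)

lemma tmul_diff_right: "tmul f (g - g') = tmul f g - tmul f g'"
  by (auto simp: tmul_def fun_eq_iff sum_subtractf algebra_simps)

lemma tmul_zero_left [simp]: "tmul 0 g = 0"
  by (auto simp: tmul_def fun_eq_iff)

lemma tmul_zero_right [simp]: "tmul f 0 = 0"
  by (auto simp: tmul_def fun_eq_iff)

lemma tmul_sum_left: "tmul (\<Sum>i\<in>I. F i) g = (\<Sum>i\<in>I. tmul (F i) g)"
  by (induction I rule: infinite_finite_induct) (simp_all add: tmul_add_left del: plus_fun_apply zero_fun_apply)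

lemma tmul_sum_right: "tmul f (\<Sum>i\<in>I. F i) = (\<Sum>i\<in>I. tmul f (F i))"
  by (induction I rule: infinite_finite_induct) (simp_all add: tmul_add_right del: plus_fun_apply zero_fun_apply)

lemma tmul_tsmul_left: "tmul (tsmul c f) g = tsmul c (tmul f g)"
  by (auto simp: tmul_def fun_eq_iff sum_distrib_left algebra_simps)

lemma tmul_tsmul_right: "tmul f (tsmul c g) = tsmul c (tmul f g)"
  by (auto simp: tmul_def fun_eq_iff sum_distrib_left algebra_simps)

lemma tmul_tone_left [simp]: "tmul tone f = f"
proof
  fix w :: "'a list"
  have "tmul (0 :: 'a list \<Rightarrow> 'b) f v = 0" for v by simp
  then show "tmul tone f w = f w"
    by (cases w) (auto simp: tmul_Nil tmul_Cons tone_def zero_fun_def)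
qed

lemma tmul_tone_right [simp]: "tmul f tone = f"
proof
  fix w show "tmul f tone w = f w"
    by (induction w arbitrary: f) (auto simp: tmul_Nil tmul_Cons tone_def)
qed

lemma tmon_Nil: "tmon [] = tone"
  by (auto simp: tmon_def tone_def)

lemma tmul_tmon: "tmul (tmon u) (tmon v) = tmon (u @ v)"
proof
  fix w show "tmul (tmon u) (tmon v) w = (tmon (u @ v) :: 'a list \<Rightarrow> 'b) w"
  proof (induction w arbitrary: u)
    case Nil
    then show ?case by (auto simp: tmul_Nil tmon_def)
  next
    case (Cons a w)
    show ?case
    proof (cases u)
      case Nil
      then show ?thesis by (simp add: tmon_Nil)
    next
      case (Cons b u')
      have "(\<lambda>x. tmon u (a # x)) = (if a = b then tmon u' else (0 :: 'a list \<Rightarrow> 'b))"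
        by (auto simp: Cons tmon_def fun_eq_iff)
      then show ?thesis
        using Cons.IH[of u'] by (auto simp: tmul_Cons Cons) (auto simp: tmon_def)
    qed
  qed
qed

lemma tmul_nonzeroE:
  assumes "tmul f g w \<noteq> 0"
  obtains u v where "w = u @ v" "f u \<noteq> 0" "g v \<noteq> 0"
proof -
  obtain i where "f (take i w) * g (drop i w) \<noteq> 0"
    using assms unfolding tmul_def by (meson sum.neutral)
  then show ?thesis using that[of "take i w" "drop i w"] by auto
qed

lemma wdeg_append [simp]: "wdeg l (u @ v) = wdeg l u + wdeg l v"
  by (simp add: wdeg_def)

lemma wdeg_simps [simp]: "wdeg l [] = 0" "wdeg l (x # w) = l x + wdeg l w"
  by (simp_all add: wdeg_def)

lemma Tc_add: "f \<in> Tc X \<Longrightarrow> g \<in> Tc X \<Longrightarrow> f + g \<in> Tc X"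
  unfolding Tc_def
  by (auto intro: finite_subset[of _ "{w. f w \<noteq> 0} \<union> {w. g w \<noteq> 0}"]) (metis add.right_neutral subsetD)

lemma Tc_tsmul: "f \<in> Tc X \<Longrightarrow> tsmul c f \<in> Tc X"
  unfolding Tc_def by (auto intro: finite_subset[of _ "{w. f w \<noteq> 0}"])

lemma Tc_uminus: "f \<in> Tc X \<Longrightarrow> - f \<in> Tc X"
  unfolding Tc_def by auto

lemma Tc_diff: "f \<in> Tc X \<Longrightarrow> g \<in> Tc X \<Longrightarrow> f - g \<in> Tc X"
  using Tc_add[of f X "- g"] Tc_uminus[of g X] by simp

lemma Tc_zero [simp]: "0 \<in> Tc X"
  by (auto simp: Tc_def)

lemma Tc_tmon: "set u \<subseteq> X \<Longrightarrow> tmon u \<in> Tc X"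
  by (auto simp: Tc_def tmon_def)

lemma Tc_tone [simp]: "tone \<in> Tc X"
  using Tc_tmon[of "[]" X] by (simp add: tmon_Nil)

lemma Tc_sum: "(\<And>i. i \<in> I \<Longrightarrow> F i \<in> Tc X) \<Longrightarrow> (\<Sum>i\<in>I. F i) \<in> Tc X"
  by (induction I rule: infinite_finite_induct) (auto intro: Tc_add)

lemma Tc_tmul:
  assumes "f \<in> Tc X" "g \<in> Tc X"
  shows "tmul f g \<in> Tc X"
proof -
  have "{w. tmul f g w \<noteq> 0} \<subseteq> (\<lambda>(u, v). u @ v) ` ({w. f w \<noteq> 0} \<times> {w. g w \<noteq> 0})"
    by (auto elim!: tmul_nonzeroE)
  moreover have "set w \<subseteq> X" if "tmul f g w \<noteq> 0" for w
    using that assms by (elim tmul_nonzeroE) (auto simp: Tc_def)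
  ultimately show ?thesis
    using assms by (auto simp: Tc_def intro: finite_subset)
qed

lemma Tc_expand:
  assumes "f \<in> Tc X"
  shows "f = (\<Sum>w | f w \<noteq> 0. tsmul (f w) (tmon w))"
proof
  fix v
  have "finite {w. f w \<noteq> 0}" using assms by (simp add: Tc_def)
  then show "f v = (\<Sum>w | f w \<noteq> 0. tsmul (f w) (tmon w)) v"
    by (simp add: sum_fun_apply tmon_def if_distrib sum.delta' cong: if_cong)
qed

section \<open>Closure properties of generated two-sided ideals\<close>

lemma ideal_gen_mult_left: "x \<in> ideal_gen X S \<Longrightarrow> a \<in> Tc X \<Longrightarrow> tmul a x \<in> ideal_gen X S"
  using ideal_gen.mult[of x X S a tone] by simp

lemma ideal_gen_mult_right: "x \<in> ideal_gen X S \<Longrightarrow> b \<in> Tc X \<Longrightarrow> tmul x b \<in> ideal_gen X S"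
  using ideal_gen.mult[of x X S tone b] by simp

lemma ideal_gen_add: "x \<in> ideal_gen X S \<Longrightarrow> y \<in> ideal_gen X S \<Longrightarrow> x + y \<in> ideal_gen X S"
  using ideal_gen.add[of x X S y] by (simp add: t_arith)

lemma ideal_gen_zero [simp]: "0 \<in> ideal_gen X S"
  using ideal_gen.zero[of X S] by (simp add: t_arith)

lemma ideal_gen_tsmul:
  assumes "x \<in> ideal_gen X S"
  shows "tsmul c x \<in> ideal_gen X S"
  using ideal_gen_mult_left[OF assms Tc_tsmul[OF Tc_tone, of c]] by (simp add: tmul_tsmul_left)

lemma ideal_gen_uminus: "x \<in> ideal_gen X S \<Longrightarrow> - x \<in> ideal_gen X S"
  using ideal_gen_tsmul[of x X S "-1"] by (simp add: tsmul_def fun_Compl_def)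

lemma ideal_gen_sum: "(\<And>i. i \<in> I \<Longrightarrow> F i \<in> ideal_gen X S) \<Longrightarrow> (\<Sum>i\<in>I. F i) \<in> ideal_gen X S"
  by (induction I rule: infinite_finite_induct) (auto intro: ideal_gen_add)

lemma ideal_gen_subset_Tc:
  assumes "S \<subseteq> Tc X" "x \<in> ideal_gen X S"
  shows "x \<in> Tc X"
  using assms(2)
proof induction
  case (add x y)
  then show ?case by (metis Tc_add tadd_eq_plus)
next
  case zero
  show ?case by (metis Tc_zero tzero_eq_zero)
qed (use assms(1) in \<open>auto intro: Tc_tmul\<close>)

section \<open>Elementary symmetric functions in noncommuting variables\<close>

primrec esym :: "('v list \<Rightarrow> 'k::field) list \<Rightarrow> nat \<Rightarrow> 'v list \<Rightarrow> 'k" where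
  "esym [] i = (if i = 0 then tone else 0)"
| "esym (e # es) i = esym es i + (if i = 0 then 0 else tmul e (esym es (i - 1)))"

lemma esym_0 [simp]: "esym es 0 = tone"
  by (induction es) auto

lemma esym_eq_0: "length es < i \<Longrightarrow> esym es i = 0"
  by (induction es arbitrary: i) auto

text \<open>\<open>esym es i\<close> is the coefficient of s^i in the ordered product of the factors
  1 + s e. Taking t out of each factor t - e leaves these factors with s = -1/t.\<close>

lemma coefs_eq_esym:
  "coefs es j = (if j \<le> length es then tsmul ((-1) ^ (length es - j)) (esym es (length es - j)) else 0)"
proof (induction es arbitrary: j)
  case Nil
  then show ?case by (auto simp: t_arith fun_eq_iff)
next
  case (Cons e es)
  consider "j = 0" | "j = Suc (length es)" | "j > Suc (length es)" | "0 < j" "j \<le> length es"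
    by linarith
  then show ?case
  proof cases
    case 1
    have "esym es (Suc (length es)) = 0" by (rule esym_eq_0) simp
    moreover have "coefs es 0 = tsmul ((-1) ^ length es) (esym es (length es))"
      using Cons.IH[of 0] by (simp del: tsmul_apply)
    ultimately show ?thesis using 1 
      by (simp add: t_arith tmul_tsmul_right)
  next
    case 4
    then obtain i where i: "j = Suc i" by (cases j) auto
    have "length es - i = Suc (length es - Suc i)" using 4 i by simp
    then show ?thesis using 4 i
      by (simp add: t_arith Cons.IH[of i] Cons.IH[of "Suc i"] tmul_tsmul_right
          del: tsmul_apply)
        (simp add: fun_eq_iff algebra_simps)
  qed (auto simp: t_arith Cons.IH tsmul_def simp del: zero_fun_apply minus_apply)
qed

text \<open>The degree of a path of \<open>k\<close> vertices that starts at level \<open>L\<close>.\<close>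

definition bdeg :: "nat \<Rightarrow> nat \<Rightarrow> nat" where
  "bdeg L k = (\<Sum>i<k. L - i)"

lemma bdeg_simps [simp]: "bdeg L 0 = 0" "bdeg L (Suc k) = bdeg L k + (L - k)"
  by (simp_all add: bdeg_def)

lemma bdeg_le: "bdeg L k \<le> k * L"
  by (induction k) auto

text \<open>The positions from \<open>i\<close> to \<open>l - 1\<close> have level at least
  \<open>X + 1\<close>, so counting each of them as \<open>X\<close> saves at least one degree per
  position. This saving makes the comparison in \<open>vact_leading\<close> strict.\<close>

lemma bdeg_below: "i \<le> l \<Longrightarrow> bdeg (X + l) i + (l - i) * X + (l - i) \<le> bdeg (X + l) l"
proof (induction "l - i" arbitrary: i)
  case (Suc d)
  then have "bdeg (X + l) (Suc i) + (l - Suc i) * X + (l - Suc i) \<le> bdeg (X + l) l"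
    by (intro Suc.hyps) auto
  moreover have "l - i = Suc (l - Suc i)" using Suc by auto
  ultimately show ?case using Suc.prems by simp
qed auto

lemma bdeg_above: "l \<le> i \<Longrightarrow> bdeg (X + l) i \<le> bdeg (X + l) l + (i - l) * X"
  by (induction i rule: dec_induct) (auto simp: Suc_diff_le)

lemma bdeg_Suc_shift: "bdeg (Suc L) (Suc k) = Suc L + bdeg L k"
  by (simp add: bdeg_def sum.lessThan_Suc_shift del: sum.lessThan_Suc)

lemma bdeg_strict_mono: "0 < k \<Longrightarrow> bdeg L k < bdeg (Suc L) k"
proof -
  assume "0 < k"
  then obtain k' where "k = Suc k'" by (cases k) auto
  moreover have "bdeg L (Suc k') < bdeg (Suc L) (Suc k')"
    by (induction k') (auto simp: Suc_diff_le)
  ultimately show ?thesis by simp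
qed

section \<open>The module of block lists\<close>

locale layered =
  fixes V :: "'v set" and E :: "('v \<times> 'v) set" and lvl :: "'v \<Rightarrow> nat" and star :: 'v
  assumes graph: "layered_graph V E lvl star"
begin

lemma lvl_edge: "(v, w) \<in> E \<Longrightarrow> lvl v = Suc (lvl w)"
  using graph by (auto simp: layered_graph_def)

lemma edge_in_V: "(v, w) \<in> E \<Longrightarrow> v \<in> V \<and> w \<in> V"
  using graph by (auto simp: layered_graph_def)

lemma star_in_V: "star \<in> V"
  using graph by (auto simp: layered_graph_def)

lemma lvl_star [simp]: "lvl star = 0"
  using graph by (auto simp: layered_graph_def)

lemma lvl_Vplus: "v \<in> Vplus V star \<Longrightarrow> 0 < lvl v"
  using graph by (auto simp: layered_graph_def Vplus_def)

lemma edge_from_Vplus: "v \<in> Vplus V star \<Longrightarrow> \<exists>w. (v, w) \<in> E"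
  using graph lvl_Vplus[of v] by (auto simp: layered_graph_def Vplus_def Suc_le_eq)

text \<open>Positivity of \<open>k\<close> keeps a block of length 0 from being continued by its own
  head.\<close>

definition reach :: "'v \<Rightarrow> nat \<Rightarrow> 'v \<Rightarrow> bool" where
  "reach b k u \<longleftrightarrow> 0 < k \<and> (b, u) \<in> E ^^ k"

lemma lvl_relpow: "(b, u) \<in> E ^^ k \<Longrightarrow> lvl b = lvl u + k"
  by (induction k arbitrary: u) (auto dest!: lvl_edge)

lemma lvl_reach: "reach b k u \<Longrightarrow> lvl b = lvl u + k"
  by (auto simp: reach_def lvl_relpow)

lemma reach_edge: "(v, w) \<in> E \<Longrightarrow> reach v 1 w"
  by (simp add: reach_def)

lemma reach_step: "reach b k v \<Longrightarrow> (v, w) \<in> E \<Longrightarrow> reach b (Suc k) w"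
  by (auto simp: reach_def)

lemma reach_unique: "reach b k u \<Longrightarrow> reach b i u \<Longrightarrow> i = k"
  by (auto dest!: lvl_reach)

lemma not_reach_self [simp]: "\<not> reach b k b"
  by (auto simp: reach_def dest!: lvl_relpow)

text \<open>
  A state is a list of blocks \<open>(b, k)\<close>, the last block of the product first. We work with arbitrary
  functions \<open>\<phi>\<close> on states, that is, with the dual module, where no finiteness of supports is needed:
  \<open>hop j x \<phi> n\<close> is the value of \<open>\<phi>\<close> at \<open>n \<cdot> h\<^sub>j(x)\<close>, where \<open>H\<^sub>x(s) = \<Sum>\<^sub>j h\<^sub>j(x) s\<^sup>j\<close>. The function \<open>free_h\<close>
  covers the case that a block of \<open>x\<close> can simply be appended; otherwise \<open>hop\<close> is forced by
  \<open>[s\<^sup>l\<^sup>+\<^sup>j] E\<^sub>c(s) H\<^sub>x(s) = 0\<close>.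
\<close>

function free_h :: "nat \<Rightarrow> 'v \<Rightarrow> (('v \<times> nat) list \<Rightarrow> 'k::field) \<Rightarrow> ('v \<times> nat) list \<Rightarrow> 'k" where
  "free_h j x \<phi> n = (if j = 0 then \<phi> n
     else - (\<Sum>i\<in>{1..min j (lvl x)}. free_h (j - i) x \<phi> ((x, i) # n)))"
  by pat_completeness auto
termination by (relation "measure fst") auto

declare free_h.simps [simp del]

fun hop :: "nat \<Rightarrow> 'v \<Rightarrow> (('v \<times> nat) list \<Rightarrow> 'k::field) \<Rightarrow> ('v \<times> nat) list \<Rightarrow> 'k" where
  "hop j x \<phi> [] = free_h j x \<phi> []"
| "hop j x \<phi> ((c, l) # m) = (if 0 < j \<and> reach c l x
     then - (\<Sum>i\<in>{1..min (l + j) (lvl c)} - {l}. free_h (l + j - i) x \<phi> ((c, i) # m)) - hop (l + j) x \<phi> m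
     else free_h j x \<phi> ((c, l) # m))"

declare hop.simps [simp del]

definition follows :: "('v \<times> nat) list \<Rightarrow> 'v \<Rightarrow> bool" where
  "follows n x \<longleftrightarrow> (\<exists>b k m. n = (b, k) # m \<and> reach b k x)"

lemma follows_simps [simp]: "\<not> follows [] x" "follows ((b, k) # m) x \<longleftrightarrow> reach b k x"
  by (auto simp: follows_def)

lemma free_h_0 [simp]: "free_h 0 x \<phi> n = \<phi> n"
  by (simp add: free_h.simps)

lemma hop_0 [simp]: "hop 0 x \<phi> n = \<phi> n"
  by (cases "(0::nat, x, \<phi>, n)" rule: hop.cases) (auto simp: hop.simps)

lemma hop_0' [simp]: "hop 0 x \<phi> = \<phi>"
  by (rule ext) simp

lemma hop_free: "\<not> follows n x \<Longrightarrow> hop j x \<phi> n = free_h j x \<phi> n"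
  by (cases "(j, x, \<phi>, n)" rule: hop.cases) (auto simp: hop.simps)

text \<open>Levels determine at which length a block of \<open>c\<close> is continued by
  \<open>x\<close>. So \<open>x\<close> does not follow \<open>(c, i)\<close> for
  \<open>i \<noteq> l\<close>, and \<open>hop\<close> may replace \<open>free_h\<close> in its own
  recursion.\<close>

lemma hop_follows:
  "reach c l x \<Longrightarrow> 0 < j \<Longrightarrow> hop j x \<phi> ((c, l) # m) =
     - (\<Sum>i\<in>{1..min (l + j) (lvl c)} - {l}. hop (l + j - i) x \<phi> ((c, i) # m)) - hop (l + j) x \<phi> m"
proof -
  assume "reach c l x" "0 < j"
  moreover have "(\<Sum>i\<in>{1..min (l + j) (lvl c)} - {l}. hop (l + j - i) x \<phi> ((c, i) # m)) =
     (\<Sum>i\<in>{1..min (l + j) (lvl c)} - {l}. free_h (l + j - i) x \<phi> ((c, i) # m))"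
    using reach_unique[OF \<open>reach c l x\<close>] by (intro sum.cong refl hop_free) auto
  ultimately show ?thesis by (simp add: hop.simps)
qed

text \<open>The coefficient of s^j in E_b H_b = 1, read at a state to which a block of
  \<open>b\<close> can be appended.\<close>

lemma hop_block_free:
  assumes "\<not> follows m b" "0 < j"
  shows "hop j b \<phi> m + (\<Sum>i\<in>{1..min j (lvl b)}. hop (j - i) b \<phi> ((b, i) # m)) = 0"
  using assms by (simp add: hop_free free_h.simps[of j])

text \<open>The bound \<open>k\<close> on the degree of E_b H_u in s, valid at every state
  \<open>m\<close>. It is the recursion of \<open>hop\<close> with the summand \<open>i = k\<close>
  moved back into the sum.\<close>

lemma hop_block_reach:
  assumes "reach b k u" "k < j"
  shows "hop j u \<phi> m + (\<Sum>i\<in>{1..min j (lvl b)}. hop (j - i) u \<phi> ((b, i) # m)) = 0"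
proof -
  have k: "k \<in> {1..min j (lvl b)}"
    using assms lvl_reach[OF assms(1)] by (auto simp: reach_def)
  show ?thesis
    using hop_follows[OF assms(1), of "j - k" \<phi> m] assms(2)
    unfolding sum.remove[OF finite_atLeastAtMost k] by simp
qed

text \<open>Indeed \<open>h\<^sub>1(x) = - e(x, 1) = - x\<close>.\<close>

definition vact :: "'v \<Rightarrow> (('v \<times> nat) list \<Rightarrow> 'k::field) \<Rightarrow> ('v \<times> nat) list \<Rightarrow> 'k" where
  "vact x \<phi> = - hop 1 x \<phi>"

lemma sum_min_split:
  fixes f :: "nat \<Rightarrow> 'b::comm_monoid_add"
  shows "(\<Sum>i\<in>{1..min (Suc j) L}. f i) = (\<Sum>i\<in>{1..min j L}. f i) + (if Suc j \<le> L then f (Suc j) else 0)"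
  by (auto simp: min_def not_le le_Suc_eq intro: arg_cong2[where f = sum])

text \<open>As \<open>\<phi>'\<close> evaluates \<open>\<phi>\<close> after acting by v - w, this is
  the coefficient of s^(j+1) in H_w = H_v (1 + s (v - w)). All terms are expanded over blocks of
  \<open>v\<close>; since \<open>v\<close> never continues its own block, the induction on
  \<open>j\<close> applies to each appended block.\<close>

lemma hop_edge_free:
  assumes "(v, w) \<in> E" "\<phi>' = vact v \<phi> - vact w \<phi>" "\<not> follows n v"
  shows "hop (Suc j) w \<phi> n = hop (Suc j) v \<phi> n + hop j v \<phi>' n"
  using assms(3)
proof (induction j arbitrary: n rule: less_induct)
  case (less j)
  show ?case
  proof (cases "j = 0")
    case True
    then show ?thesis by (simp add: assms(2) vact_def)
  next
    case False
    have IH: "hop (Suc j - i) w \<phi> ((v, i) # n) =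
        hop (Suc j - i) v \<phi> ((v, i) # n) + hop (j - i) v \<phi>' ((v, i) # n)"
      if "i \<in> {1..min j (lvl v)}" for i
      using less.IH[of "j - i" "(v, i) # n"] that False by (auto simp: Suc_diff_le)
    have "hop (Suc j) w \<phi> n = - (\<Sum>i\<in>{1..min (Suc j) (lvl v)}. hop (Suc j - i) w \<phi> ((v, i) # n))"
      using hop_block_reach[OF reach_edge[OF assms(1)], of "Suc j" \<phi> n] False
      by (simp add: eq_neg_iff_add_eq_0)
    also have "\<dots> = - (\<Sum>i\<in>{1..min (Suc j) (lvl v)}. hop (Suc j - i) v \<phi> ((v, i) # n))
                 - (\<Sum>i\<in>{1..min j (lvl v)}. hop (j - i) v \<phi>' ((v, i) # n))"
      \<comment> \<open>The extra summand \<open>i = Suc j\<close> involves only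
        \<open>hop 0\<close>, which is the same for \<open>v\<close> and \<open>w\<close>.\<close>
      unfolding sum_min_split using IH by (simp add: sum.distrib)
    also have "\<dots> = hop (Suc j) v \<phi> n + hop j v \<phi>' n"
      using hop_block_free[OF less.prems, of "Suc j" \<phi>] hop_block_free[OF less.prems, of j \<phi>'] False
      by (simp add: eq_neg_iff_add_eq_0[symmetric])
    finally show ?thesis .
  qed
qed

text \<open>
  The relation \<open>H\<^sub>w = H\<^sub>v (1 + s (v - w))\<close>. If \<open>v\<close> continues the last block \<open>(b, k)\<close>, both
  \<open>E\<^sub>b H\<^sub>w\<close> and \<open>E\<^sub>b H\<^sub>v (1 + s (v - w))\<close> have degree at most \<open>k + 1\<close>; their difference is \<open>s\<^sup>k\<close> times the
  defect of the relation at \<open>(b, k) # m\<close>, whose coefficients of \<open>s\<^sup>0\<close> and \<open>s\<^sup>1\<close> vanish trivially.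
\<close>

lemma hop_edge:
  fixes \<phi> :: "('v \<times> nat) list \<Rightarrow> 'k::field"
  assumes "(v, w) \<in> E" "\<phi>' = vact v \<phi> - vact w \<phi>"
  shows "hop (Suc j) w \<phi> n = hop (Suc j) v \<phi> n + hop j v \<phi>' n"
proof (induction n arbitrary: j)
  case Nil
  then show ?case using assms by (intro hop_edge_free) auto
next
  case (Cons p m)
  obtain b k where p: "p = (b, k)" by (cases p)
  consider "j = 0" | "\<not> reach b k v" | "reach b k v" "0 < j" by auto
  then show ?case
  proof cases
    case 1
    then show ?thesis by (simp add: assms(2) vact_def)
  next
    case 2
    then show ?thesis unfolding p using assms by (intro hop_edge_free) auto
  next
    case 3
    \<comment> \<open>The summand \<open>i = k\<close> in degree J + 1 of the product with E_b is
      the defect of the relation in degree j + 1.\<close>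
    define J where "J = k + j"
    let ?I = "{1..min J (lvl b)}"
    have k: "k \<in> ?I" and kJ: "k < J"
      using 3 lvl_reach[OF 3(1)] by (auto simp: reach_def J_def)
    let ?D = "\<lambda>i. hop (Suc J - i) w \<phi> ((b, i) # m)
        - (hop (Suc J - i) v \<phi> ((b, i) # m) + hop (J - i) v \<phi>' ((b, i) # m))"
    \<comment> \<open>For \<open>i \<noteq> k\<close> the vertex \<open>v\<close> does not continue
      \<open>(b, i)\<close>, so the free case applies.\<close>
    have free: "?D i = 0" if "i \<in> ?I - {k}" for i
      using hop_edge_free[OF assms(1,2), of "(b, i) # m" "J - i"] that reach_unique[OF 3(1), of i]
      by (auto simp: Suc_diff_le)
    \<comment> \<open>As \<open>0 < j\<close>, the coefficients of all three products with E_b lie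
      beyond their degree bounds and vanish; the terms at \<open>m\<close> then cancel by the
      induction hypothesis.\<close>
    have "(\<Sum>i\<in>?I. ?D i) = 0"
    proof -
      have w: "hop (Suc J) w \<phi> m + (\<Sum>i\<in>{1..min (Suc J) (lvl b)}. hop (Suc J - i) w \<phi> ((b, i) # m)) = 0"
        using kJ by (intro hop_block_reach[OF reach_step[OF 3(1) assms(1)]]) simp
      have v: "hop (Suc J) v \<phi> m + (\<Sum>i\<in>{1..min (Suc J) (lvl b)}. hop (Suc J - i) v \<phi> ((b, i) # m)) = 0"
        using kJ by (intro hop_block_reach[OF 3(1)]) simp
      have v': "hop J v \<phi>' m + (\<Sum>i\<in>?I. hop (J - i) v \<phi>' ((b, i) # m)) = 0"
        using kJ by (intro hop_block_reach[OF 3(1)])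
      have "s - (t + t') = 0" if "a + (s + c) = 0" "b + (t + c) = 0" "b' + t' = 0" "a = b + b'"
        for a b b' c s t t' :: 'k
        using that by algebra
      from this[OF w[unfolded sum_min_split] _ v' Cons.IH] v show ?thesis
        unfolding sum_min_split by (simp only: sum_subtractf sum.distrib hop_0 diff_self_eq_0)
    qed
    then have "?D k = 0" using free unfolding sum.remove[OF finite_atLeastAtMost k] by simp
    then show ?thesis using kJ by (simp add: p J_def Suc_diff_le)
  qed
qed

end

lemmas fun_ops = plus_fun_apply zero_fun_apply minus_apply uminus_apply tsmul_apply

text \<open>As simp rules these eta-expand sums of functions, which then escape laws such as \<open>hop_add\<close>.\<close>

declare fun_ops [simp del]

context layered
begin

section \<open>The action of the free algebra on functions of states\<close>

lemma free_h_add: "free_h j x (\<phi> + \<psi>) n = free_h j x \<phi> n + free_h j x \<psi> n"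
proof (induction j arbitrary: n rule: less_induct)
  case (less j)
  then show ?case
    by (simp add: free_h.simps[of j] sum.distrib fun_ops)
qed

lemma free_h_tsmul: "free_h j x (tsmul c \<phi>) n = c * free_h j x \<phi> n"
proof (induction j arbitrary: n rule: less_induct)
  case (less j)
  then show ?case
    by (simp add: free_h.simps[of j] sum_distrib_left fun_ops)
qed

lemma hop_add: "hop j x (\<phi> + \<psi>) n = hop j x \<phi> n + hop j x \<psi> n"
  by (induction n arbitrary: j) (auto simp: hop.simps free_h_add sum.distrib)

lemma hop_tsmul: "hop j x (tsmul c \<phi>) n = c * hop j x \<phi> n"
  by (induction n arbitrary: j) (auto simp: hop.simps free_h_tsmul sum_distrib_left algebra_simps)

lemma hop_zero [simp]: "hop j x 0 n = 0"
  using hop_tsmul[of j x 0 0 n] by (simp add: tsmul_def zero_fun_def)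

lemma vact_add: "vact x (\<phi> + \<psi>) = vact x \<phi> + vact x \<psi>"
  by (rule ext) (simp add: vact_def hop_add fun_ops) 

lemma vact_tsmul: "vact x (tsmul c \<phi>) = tsmul c (vact x \<phi>)"
  by (rule ext) (simp add: vact_def hop_tsmul fun_ops)

text \<open>E_* = 1, hence H_* = 1: at level 0 no block can be appended, and a block continued by
  \<open>star\<close> already has its full length \<open>lvl c\<close>. This agrees with
  \<open>vimg\<close> sending \<open>star\<close> to zero.\<close>

lemma hop_star: "0 < j \<Longrightarrow> hop j star \<phi> n = 0"
proof (induction n arbitrary: j)
  case Nil
  then show ?case by (simp add: hop.simps free_h.simps[of j])
next
  case (Cons p m)
  obtain c l where p: "p = (c, l)" by (cases p)
  show ?case
  proof (cases "reach c l star")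
    case True
    then have "lvl c = l" using lvl_reach by fastforce
    then have "(\<Sum>i\<in>{1..min (l + j) (lvl c)} - {l}. free_h (l + j - i) star \<phi> ((c, i) # m)) = 0"
      using Cons.prems by (intro sum.neutral) (auto simp: free_h.simps[of "_ - _"])
    then show ?thesis using True Cons by (simp add: p hop.simps)
  next
    case False
    then show ?thesis using Cons.prems by (simp add: p hop.simps free_h.simps[of j])
  qed
qed

lemma vact_star: "vact star \<phi> = 0"
  by (rule ext) (simp add: vact_def hop_star fun_ops)

text \<open>The right action on states is a left action on functions: \<open>wact w \<phi> n\<close>
  is the value of \<open>\<phi>\<close> at n acted on by the letters of \<open>w\<close> from left
  to right.\<close>

primrec wact :: "'v list \<Rightarrow> (('v \<times> nat) list \<Rightarrow> 'k::field) \<Rightarrow> ('v \<times> nat) list \<Rightarrow> 'k" where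
  "wact [] \<phi> = \<phi>"
| "wact (x # w) \<phi> = vact x (wact w \<phi>)"

lemma wact_append: "wact (u @ v) \<phi> = wact u (wact v \<phi>)"
  by (induction u) auto

lemma wact_add: "wact w (\<phi> + \<psi>) = wact w \<phi> + wact w \<psi>"
  by (induction w) (simp_all add: vact_add)

lemma wact_tsmul: "wact w (tsmul c \<phi>) = tsmul c (wact w \<phi>)"
  by (induction w) (simp_all add: vact_tsmul)

lemma wact_zero [simp]: "wact w 0 = 0"
  using wact_tsmul[of w 0 0] by (simp add: tsmul_def zero_fun_def)

lemma wact_sum: "wact w (\<Sum>i\<in>I. F i) = (\<Sum>i\<in>I. wact w (F i))"
  by (induction I rule: infinite_finite_induct)
    (simp_all add: wact_add)

definition tact :: "('v list \<Rightarrow> 'k::field) \<Rightarrow> (('v \<times> nat) list \<Rightarrow> 'k) \<Rightarrow> ('v \<times> nat) list \<Rightarrow> 'k" where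
  "tact f \<phi> = (\<Sum>w | f w \<noteq> 0. tsmul (f w) (wact w \<phi>))"

lemma tact_superset:
  assumes "finite S" "{w. f w \<noteq> 0} \<subseteq> S"
  shows "tact f \<phi> = (\<Sum>w\<in>S. tsmul (f w) (wact w \<phi>))"
  unfolding tact_def using assms
  by (intro sum.mono_neutral_left) (auto simp: fun_ops fun_eq_iff)

lemma tact_add:
  fixes f g :: "'v list \<Rightarrow> 'k::field"
  assumes "f \<in> Tc X" "g \<in> Tc X"
  shows "tact (f + g) \<phi> = tact f \<phi> + tact g \<phi>"
proof -
  let ?S = "{w. f w \<noteq> 0} \<union> {w. g w \<noteq> 0}"
  have "finite ?S" using assms by (auto simp: Tc_def)
  moreover have "{w. (f + g) w \<noteq> 0} \<subseteq> ?S" by (auto simp: fun_ops)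
  moreover have "tsmul ((f + g) w) \<psi> = tsmul (f w) \<psi> + tsmul (g w) \<psi>" for w and \<psi> :: "('v \<times> nat) list \<Rightarrow> 'k"
    by (rule ext) (simp add: distrib_right fun_ops)
  ultimately show ?thesis
    by (simp add: tact_superset[of ?S] sum.distrib)
qed

lemma tact_tsmul:
  assumes "f \<in> Tc X"
  shows "tact (tsmul c f) \<phi> = tsmul c (tact f \<phi>)"
proof -
  have "tact (tsmul c f) \<phi> = (\<Sum>w | f w \<noteq> 0. tsmul (tsmul c f w) (wact w \<phi>))"
    using assms by (intro tact_superset) (auto simp: Tc_def fun_ops)
  then show ?thesis
    by (auto simp: tact_def fun_eq_iff sum_fun_apply sum_distrib_left mult.assoc fun_ops)
qed

lemma tact_zero [simp]: "tact 0 \<phi> = 0" "tact f 0 = 0"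
  by (auto simp: tact_def fun_eq_iff sum_fun_apply fun_ops)

lemma tact_tmon: "tact (tmon w) \<phi> = wact w \<phi>"
  by (subst tact_superset[of "{w}"]) (auto simp: tmon_def tsmul_def)

lemma tact_tone: "tact tone \<phi> = \<phi>"
  using tact_tmon[of "[]"] by (simp add: tmon_Nil)

lemma tact_sum:
  assumes "\<And>i. i \<in> I \<Longrightarrow> F i \<in> Tc X"
  shows "tact (\<Sum>i\<in>I. F i) \<phi> = (\<Sum>i\<in>I. tact (F i) \<phi>)"
  using assms
proof (induction I rule: infinite_finite_induct)
  case (insert x I)
  then have "tact (F x + (\<Sum>i\<in>I. F i)) \<phi> = tact (F x) \<phi> + tact (\<Sum>i\<in>I. F i) \<phi>"
    by (intro tact_add[of _ X] Tc_sum) auto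
  then show ?case using insert by (simp)
qed (simp_all)

lemma tact_diff:
  assumes "f \<in> Tc X" "g \<in> Tc X"
  shows "tact (f - g) \<phi> = tact f \<phi> - tact g \<phi>"
  using tact_add[of "f - g" X g \<phi>] assms by (simp add: Tc_diff)

lemma tact_tmul:
  assumes "f \<in> Tc X" "g \<in> Tc X"
  shows "tact (tmul f g) \<phi> = tact f (tact g \<phi>)"
proof -
  have mon: "tact (tmul (tmon u) g) \<phi> = wact u (tact g \<phi>)" if "set u \<subseteq> X" for u
  proof -
    have "tmul (tmon u) g = (\<Sum>w | g w \<noteq> 0. tsmul (g w) (tmon (u @ w)))"
      by (subst Tc_expand[OF assms(2)]) (simp only: tmul_sum_right tmul_tsmul_right tmul_tmon)
    moreover have tc: "tmon (u @ w) \<in> Tc X" if "g w \<noteq> 0" for w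
      using that assms(2) \<open>set u \<subseteq> X\<close> by (intro Tc_tmon) (auto simp: Tc_def)
    ultimately have "tact (tmul (tmon u) g) \<phi> = (\<Sum>w | g w \<noteq> 0. tact (tsmul (g w) (tmon (u @ w))) \<phi>)"
      by (simp only:) (intro tact_sum[of _ _ X] Tc_tsmul, simp)
    also have "\<dots> = (\<Sum>w | g w \<noteq> 0. tsmul (g w) (wact u (wact w \<phi>)))"
      by (intro sum.cong refl) (simp add: tact_tsmul[OF tc] tact_tmon wact_append)
    finally show ?thesis by (simp add: tact_def[of g] wact_sum wact_tsmul)
  qed
  have "tmul f g = (\<Sum>w | f w \<noteq> 0. tsmul (f w) (tmul (tmon w) g))"
    by (subst Tc_expand[OF assms(1)]) (simp only: tmul_sum_left tmul_tsmul_left)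
  moreover have tc: "tmul (tmon w) g \<in> Tc X" "set w \<subseteq> X" if "f w \<noteq> 0" for w
  proof -
    show "set w \<subseteq> X" using that assms(1) by (auto simp: Tc_def)
    then show "tmul (tmon w) g \<in> Tc X" by (intro Tc_tmul Tc_tmon assms(2))
  qed
  ultimately have "tact (tmul f g) \<phi> = (\<Sum>w | f w \<noteq> 0. tact (tsmul (f w) (tmul (tmon w) g)) \<phi>)"
    by (simp only:) (intro tact_sum[of _ _ X] Tc_tsmul, simp)
  also have "\<dots> = (\<Sum>w | f w \<noteq> 0. tsmul (f w) (wact w (tact g \<phi>)))"
    by (intro sum.cong refl) (simp add: tact_tsmul[OF tc(1)] mon tc(2))
  finally show ?thesis by (simp add: tact_def[of f])
qed

abbreviation VP :: "'v set" where "VP \<equiv> Vplus V star"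

lemma Tc_vimg: "v \<in> V \<Longrightarrow> vimg star v \<in> Tc VP"
  by (auto simp: vimg_def t_arith Vplus_def intro!: Tc_tmon)

lemma Tc_eimg: "v \<in> V \<Longrightarrow> w \<in> V \<Longrightarrow> eimg star (v, w) \<in> Tc VP"
  by (simp add: eimg_def t_arith Tc_diff Tc_vimg)

lemma tact_eimg: "v \<in> V \<Longrightarrow> w \<in> V \<Longrightarrow> tact (eimg star (v, w)) \<phi> = vact v \<phi> - vact w \<phi>"
proof -
  have "tact (vimg star v) \<phi> = vact v \<phi>" for v
    using tact_tmon[of "[v]" \<phi>] by (simp add: vimg_def t_arith vact_star)
  then show "v \<in> V \<Longrightarrow> w \<in> V \<Longrightarrow> tact (eimg star (v, w)) \<phi> = vact v \<phi> - vact w \<phi>"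
    by (simp add: eimg_def t_arith tact_diff[OF Tc_vimg Tc_vimg])
qed

lemma vpath_Cons2: "vpath X F (v # w # p) \<longleftrightarrow> v \<in> X \<and> (v, w) \<in> F \<and> vpath X F (w # p)"
  by (auto simp: vpath_def nth_Cons less_Suc_eq_0_disj split: nat.splits)

lemma vpath_single: "vpath X F [v] \<longleftrightarrow> v \<in> X"
  by (auto simp: vpath_def)

section \<open>The relations of A(\<Gamma>) act by zero\<close>

definition eimgs :: "'v list \<Rightarrow> ('v list \<Rightarrow> 'k::field) list" where
  "eimgs p = map (eimg star) (epath p)"

lemma eimgs_simps [simp]: "eimgs [v] = []" "eimgs (v # w # p) = eimg star (v, w) # eimgs (w # p)"
  by (simp_all add: eimgs_def epath_def)

lemma length_eimgs [simp]: "length (eimgs p) = length p - 1"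
  by (simp add: eimgs_def epath_def)

lemma Tc_esym_path: "vpath V E p \<Longrightarrow> esym (eimgs p) i \<in> Tc VP"
proof (induction p arbitrary: i rule: induct_list012)
  case (3 v w p)
  then show ?case
    using edge_in_V[of v w] by (auto simp: vpath_Cons2 intro!: Tc_add Tc_tmul Tc_eimg)
qed (auto simp: eimgs_def epath_def)

text \<open>Applying H_w = H_v (1 + s (v - w)) edge after edge telescopes: H at the first vertex
  times the product of the factors 1 + s e is H at the last vertex. This is the coefficient of
  s^j.\<close>

lemma hop_path:
  assumes "vpath V E p"
  shows "(\<Sum>i\<le>j. hop (j - i) (hd p) (tact (esym (eimgs p) i) \<phi>) n) = hop j (last p) \<phi> n"
  using assms
proof (induction p arbitrary: j rule: induct_list012)
  case 1
  then show ?case by (simp add: vpath_def)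
next
  case (2 v)
  have "(\<Sum>i\<le>j. hop (j - i) v (tact (if i = 0 then tone else 0) \<phi>) n)
      = (\<Sum>i\<le>j. if i = 0 then hop j v \<phi> n else 0)"
  proof (intro sum.cong refl)
    fix i
    show "hop (j - i) v (tact (if i = 0 then tone else 0) \<phi>) n = (if i = 0 then hop j v \<phi> n else 0)"
      by (auto simp: tact_tone)
  qed
  then show ?case by simp
next
  case (3 v w p)
  then have vw: "(v, w) \<in> E" "v \<in> V" "w \<in> V" and p: "vpath V E (w # p)"
    using edge_in_V by (auto simp: vpath_Cons2)
  define \<phi>s where "\<phi>s i = tact (esym (eimgs (w # p)) i) \<phi>" for i
  have esym: "tact (esym (eimgs (v # w # p)) i) \<phi> =
      \<phi>s i + (if i = 0 then 0 else vact v (\<phi>s (i - 1)) - vact w (\<phi>s (i - 1)))" for i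
    using vw
    by (cases i) (simp_all add: \<phi>s_def tact_eimg tact_tmul[OF Tc_eimg Tc_esym_path[OF p]]
        tact_add[OF Tc_esym_path[OF p] Tc_tmul[OF Tc_eimg Tc_esym_path[OF p]]])
  have IH: "(\<Sum>i\<le>j. hop (j - i) w (\<phi>s i) n) = hop j (last (w # p)) \<phi> n" for j
    using "3.IH"(2)[OF p] by (simp add: \<phi>s_def)
  show ?case
  proof (cases j)
    case 0
    then show ?thesis by (simp add: tact_tone)
  next
    case (Suc j')
    have "(\<Sum>i\<le>j. hop (j - i) v (tact (esym (eimgs (v # w # p)) i) \<phi>) n)
      = (\<Sum>i\<le>j. hop (j - i) v (\<phi>s i) n)
        + (\<Sum>i\<le>j. hop (j - i) v (if i = 0 then 0 else vact v (\<phi>s (i - 1)) - vact w (\<phi>s (i - 1))) n)"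
      unfolding esym hop_add sum.distrib ..
    also have "(\<Sum>i\<le>j. hop (j - i) v (if i = 0 then 0 else vact v (\<phi>s (i - 1)) - vact w (\<phi>s (i - 1))) n)
      = (\<Sum>i\<le>j'. hop (j' - i) v (vact v (\<phi>s i) - vact w (\<phi>s i)) n)"
      by (simp only: Suc sum.atMost_Suc_shift) simp
    also have "(\<Sum>i\<le>j. hop (j - i) v (\<phi>s i) n) + \<dots> =
        \<phi>s j n + (\<Sum>i\<le>j'. hop (Suc (j' - i)) v (\<phi>s i) n + hop (j' - i) v (vact v (\<phi>s i) - vact w (\<phi>s i)) n)"
      by (simp add: Suc sum.distrib Suc_diff_le)
    also have "\<dots> = \<phi>s j n + (\<Sum>i\<le>j'. hop (Suc (j' - i)) w (\<phi>s i) n)"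
      by (simp add: hop_edge[OF vw(1) refl])
    also have "\<dots> = (\<Sum>i\<le>j. hop (j - i) w (\<phi>s i) n)"
      by (simp add: Suc Suc_diff_le)
    finally show ?thesis using IH by simp
  qed
qed

text \<open>By \<open>hop_path\<close> both paths satisfy the same equations, and since
  \<open>hop 0\<close> is the identity the coefficient \<open>j\<close> can be solved for in terms
  of the lower ones.\<close>

lemma tact_esym_path_unique:
  assumes "vpath V E p" "vpath V E q" "hd p = hd q" "last p = last q"
  shows "tact (esym (eimgs p) j) \<phi> = tact (esym (eimgs q) j) \<phi>"
proof (induction j rule: less_induct)
  case (less j)
  show ?case
  proof
    fix n
    have "(\<Sum>i\<le>j. hop (j - i) (hd p) (tact (esym (eimgs p) i) \<phi>) n) =
        (\<Sum>i\<le>j. hop (j - i) (hd q) (tact (esym (eimgs q) i) \<phi>) n)"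
      unfolding hop_path[OF assms(1)] hop_path[OF assms(2)] assms(4) ..
    then show "tact (esym (eimgs p) j) \<phi> n = tact (esym (eimgs q) j) \<phi> n"
      using less assms(3) by (simp flip: lessThan_Suc_atMost)
  qed
qed

lemma coefs_eimgs:
  "coefs (eimgs p) j = (if j \<le> length p - 1
     then tsmul ((-1) ^ (length p - 1 - j)) (esym (eimgs p) (length p - 1 - j)) else 0)"
  by (simp add: coefs_eq_esym)

lemma RV_gens_Tc: "RV_gens V E star \<subseteq> Tc VP"
proof -
  have "coefs (map (eimg star) (epath p)) j \<in> Tc VP" if "vpath V E p" for p j
    unfolding eimgs_def[symmetric] coefs_eimgs using that by (auto intro!: Tc_tsmul Tc_esym_path)
  then show ?thesis
    by (auto simp: RV_gens_def t_arith intro!: Tc_diff)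
qed

text \<open>This makes the action factor through A(\<Gamma>): up to sign the generators are
  differences of \<open>esym\<close> for two paths with common ends.\<close>

lemma RV_tact_zero: "x \<in> RV V E star \<Longrightarrow> tact x \<phi> = 0"
  unfolding RV_def
proof (induction arbitrary: \<phi> rule: ideal_gen.induct)
  case zero
  then show ?case by (simp add: t_arith)
next
  case (gen s)
  then obtain p q j where pq: "vpath V E p" "vpath V E q" "length p = length q" "hd p = hd q" "last p = last q"
    and s: "s = coefs (eimgs p) j - coefs (eimgs q) j"
    by (auto simp: RV_gens_def t_arith eimgs_def)
  have Tc: "coefs (eimgs p) j \<in> Tc VP" "coefs (eimgs q) j \<in> Tc VP"
    using pq by (auto simp: coefs_eimgs intro!: Tc_tsmul Tc_esym_path)
  have "tact (coefs (eimgs p) j) \<phi> = tact (coefs (eimgs q) j) \<phi>"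
    using pq by (simp add: coefs_eimgs tact_tsmul[OF Tc_esym_path] tact_esym_path_unique[OF pq(1,2,4,5)])
  then show ?case by (simp add: s tact_diff[OF Tc])
next
  case (add x y)
  then have "x \<in> Tc VP" "y \<in> Tc VP"
    by (auto intro: ideal_gen_subset_Tc[OF RV_gens_Tc])
  then show ?case using add by (simp add: t_arith tact_add)
next
  case (mult x a b)
  then have "x \<in> Tc VP"
    by (auto intro: ideal_gen_subset_Tc[OF RV_gens_Tc])
  then show ?case
    by (simp add: tact_tmul[OF Tc_tmul[OF mult.hyps(2)] mult.hyps(3)] tact_tmul[OF mult.hyps(2)] mult.IH)
qed

section \<open>Normal forms and leading forms\<close>

definition sdeg :: "('v \<times> nat) list \<Rightarrow> nat" where
  "sdeg n = (\<Sum>(b, k)\<leftarrow>n. bdeg (lvl b) k)"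

lemma sdeg_simps [simp]: "sdeg [] = 0" "sdeg ((b, k) # n) = bdeg (lvl b) k + sdeg n"
  by (simp_all add: sdeg_def)

text \<open>The dual filtration: upper bounds for the degrees occurring in an action on states
  become vanishing statements for functions.\<close>

definition vanishes_below :: "nat \<Rightarrow> (('v \<times> nat) list \<Rightarrow> 'k::field) \<Rightarrow> bool" where
  "vanishes_below d \<phi> \<longleftrightarrow> (\<forall>n. sdeg n < d \<longrightarrow> \<phi> n = 0)"

lemma free_h_vanishes:
  assumes "vanishes_below d \<phi>" "sdeg n + j * lvl x < d"
  shows "free_h j x \<phi> n = 0"
  using assms(2)
proof (induction j arbitrary: n rule: less_induct)
  case (less j)
  have "free_h (j - i) x \<phi> ((x, i) # n) = 0" if "i \<in> {1..min j (lvl x)}" for i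
  proof (rule less.IH)
    have "bdeg (lvl x) i + (j - i) * lvl x \<le> i * lvl x + (j - i) * lvl x"
      using bdeg_le[of "lvl x" i] by simp
    also have "\<dots> = j * lvl x" using that by (simp add: distrib_right[symmetric])
    finally show "sdeg ((x, i) # n) + (j - i) * lvl x < d" using less.prems by simp
  qed (use that in auto)
  then show ?case
    using assms(1) less.prems by (simp add: free_h.simps[of j] vanishes_below_def)
qed

text \<open>Dually, h_j(x) raises the degree of a state by at most \<open>j * lvl x\<close>.\<close>

lemma hop_vanishes:
  assumes "vanishes_below d \<phi>" "sdeg n + j * lvl x < d"
  shows "hop j x \<phi> n = 0"
  using assms(2)
proof (induction n arbitrary: j)
  case Nil
  then show ?case using free_h_vanishes[OF assms(1)] by (simp add: hop.simps)
next
  case (Cons p m)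
  obtain c l where p: "p = (c, l)" by (cases p)
  show ?case
  proof (cases "0 < j \<and> reach c l x")
    case False
    then show ?thesis
      using free_h_vanishes[OF assms(1), of "p # m" j x] Cons.prems by (auto simp: p hop.simps)
  next
    case True
    then have c: "lvl c = lvl x + l" using lvl_reach by blast
    \<comment> \<open>Resizing the block from \<open>l\<close> to \<open>i\<close> and then acting
      by the remaining h_(l+j-i)(x) respects the bound; \<open>i = 0\<close> is the removal of the
      block.\<close>
    have le: "bdeg (lvl c) i + (l + j - i) * lvl x \<le> bdeg (lvl c) l + j * lvl x" if "i \<le> l + j" for i
    proof (cases "i \<le> l")
      case True
      then have "(l + j - i) * lvl x = (l - i) * lvl x + j * lvl x"
        by (simp add: distrib_right[symmetric])
      then show ?thesis using bdeg_below[OF True, of "lvl x"] c by simp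
    next
      case False
      then have "(l + j - i) * lvl x + (i - l) * lvl x = j * lvl x"
        using that by (simp add: distrib_right[symmetric])
      then show ?thesis using bdeg_above[of l i "lvl x"] c False by simp
    qed
    have "free_h (l + j - i) x \<phi> ((c, i) # m) = 0" if "i \<in> {1..min (l + j) (lvl c)} - {l}" for i
      using le[of i] that Cons.prems by (intro free_h_vanishes[OF assms(1)]) (simp add: p)
    moreover have "hop (l + j) x \<phi> m = 0"
      using le[of 0] Cons.prems by (intro Cons.IH) (simp add: p)
    ultimately show ?thesis using True by (simp add: p hop.simps)
  qed
qed

text \<open>The top-degree term in the action of one letter; iterated from the empty state it
  computes the normal form of a word.\<close>

definition extend :: "('v \<times> nat) list \<Rightarrow> 'v \<Rightarrow> ('v \<times> nat) list" where
  "extend n x = (if follows n x then (fst (hd n), Suc (snd (hd n))) # tl n else (x, 1) # n)"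

lemma sdeg_extend: "sdeg (extend n x) = sdeg n + lvl x"
  by (auto simp: extend_def follows_def dest: lvl_reach)

text \<open>If \<open>x\<close> continues a block of length l, only the block of length l + 1 keeps
  the full degree in the recursion for \<open>hop\<close>. Its sign cancels against the one in
  \<open>vact\<close>, so the coefficient is 1.\<close>

lemma vact_leading:
  assumes "vanishes_below d \<phi>" "sdeg n + lvl x \<le> d" "0 < lvl x"
  shows "vact x \<phi> n = \<phi> (extend n x)"
proof (cases "follows n x")
  case False
  then show ?thesis
    using assms(3) by (simp add: vact_def fun_ops hop_free free_h.simps[of 1] free_h.simps[of "Suc 0"] extend_def min_def Suc_le_eq)
next
  case True
  then obtain c l m where n: "n = (c, l) # m" and r: "reach c l x" by (auto simp: follows_def)
  have c: "lvl c = lvl x + l" and l: "0 < l" using lvl_reach[OF r] r by (auto simp: reach_def)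
  have lt: "bdeg (lvl c) i + (Suc l - i) * lvl x < bdeg (lvl c) l + lvl x" if "i < l" for i
  proof -
    have "Suc l - i = Suc (l - i)" using that by simp
    then show ?thesis using bdeg_below[of i l "lvl x"] c that by simp
  qed
  \<comment> \<open>Positivity of \<open>lvl x\<close> gives \<open>Suc l \<le> lvl c\<close>, so
    the lengthened block does occur.\<close>
  have "{1..min (l + 1) (lvl c)} - {l} = insert (Suc l) {1..<l}"
    using c l assms(3) by auto
  moreover have "(\<Sum>i\<in>{1..<l}. hop (l + 1 - i) x \<phi> ((c, i) # m)) = 0"
    using lt assms(2) by (intro sum.neutral ballI hop_vanishes[OF assms(1)]) (fastforce simp: n)
  moreover have "hop (l + 1) x \<phi> m = 0"
    using lt[OF l] assms(2) by (intro hop_vanishes[OF assms(1)]) (simp add: n)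
  ultimately have "hop 1 x \<phi> n = - \<phi> ((c, Suc l) # m)"
    unfolding n hop_follows[OF r zero_less_one] by simp
  then show ?thesis using True by (simp add: vact_def fun_ops extend_def n)
qed

lemma sdeg_extends: "sdeg (foldl extend n w) = sdeg n + wdeg lvl w"
  by (induction w arbitrary: n) (auto simp: sdeg_extend)

lemma wact_leading:
  assumes "vanishes_below d \<phi>" "set w \<subseteq> VP" "sdeg n + wdeg lvl w \<le> d"
  shows "wact w \<phi> n = \<phi> (foldl extend n w)"
  using assms(2,3)
proof (induction w arbitrary: n)
  case (Cons x w)
  \<comment> \<open>The word \<open>w\<close> raises degrees by at most \<open>wdeg lvl w\<close>,
    so \<open>vact_leading\<close> still applies to the letter in front of it.\<close>
  have "vanishes_below (d - wdeg lvl w) (wact w \<phi>)"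
    unfolding vanishes_below_def
  proof (intro allI impI)
    fix n assume n: "sdeg n < d - wdeg lvl w"
    then have "wact w \<phi> n = \<phi> (foldl extend n w)" using Cons by simp
    then show "wact w \<phi> n = 0"
      using assms(1) n by (simp add: vanishes_below_def sdeg_extends)
  qed
  then have "vact x (wact w \<phi>) n = wact w \<phi> (extend n x)"
    using Cons.prems lvl_Vplus[of x] by (intro vact_leading) auto
  then show ?case using Cons by (simp add: sdeg_extend)
qed simp

section \<open>Normal forms modulo \<open>Rgr\<close>\<close>

definition next_vertex :: "'v \<Rightarrow> 'v" where
  "next_vertex v = (SOME w. (v, w) \<in> E)"

text \<open>A fixed representative of the paths in V_+ with \<open>k\<close> vertices from
  \<open>b\<close>, all of which agree modulo \<open>Rgr\<close>.\<close>

primrec chosen_path :: "'v \<Rightarrow> nat \<Rightarrow> 'v list" where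
  "chosen_path b 0 = []"
| "chosen_path b (Suc k) = b # chosen_path (next_vertex b) k"

primrec word_of :: "('v \<times> nat) list \<Rightarrow> 'v list" where
  "word_of [] = []"
| "word_of (p # m) = word_of m @ chosen_path (fst p) (snd p)"

lemma length_chosen_path [simp]: "length (chosen_path b k) = k"
  by (induction k arbitrary: b) auto

lemma hd_chosen_path: "0 < k \<Longrightarrow> hd (chosen_path b k) = b"
  by (cases k) auto

lemma next_vertex_edge: "v \<in> VP \<Longrightarrow> (v, next_vertex v) \<in> E"
  unfolding next_vertex_def using edge_from_Vplus by (metis someI_ex)

lemma lvl_pos_Vplus: "v \<in> V \<Longrightarrow> 0 < lvl v \<Longrightarrow> v \<in> VP"
  by (auto simp: Vplus_def)

lemma vpath_chosen_path: "b \<in> VP \<Longrightarrow> 0 < k \<Longrightarrow> k \<le> lvl b \<Longrightarrow> vpath VP E (chosen_path b k)"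
proof (induction k arbitrary: b)
  case (Suc k)
  show ?case
  proof (cases k)
    case 0
    then show ?thesis using Suc.prems by (simp add: vpath_single)
  next
    case (Suc k')
    let ?c = "next_vertex b"
    have e: "(b, ?c) \<in> E" using Suc.prems by (intro next_vertex_edge)
    then have "?c \<in> VP" "k \<le> lvl ?c" using lvl_edge[OF e] edge_in_V[OF e] Suc.prems Suc
      by (auto intro: lvl_pos_Vplus)
    then have "vpath VP E (chosen_path ?c k)" using Suc by (intro Suc.IH) auto
    then show ?thesis using e Suc.prems Suc by (simp add: vpath_Cons2)
  qed
qed simp

lemma vpath_snoc:
  assumes "p \<noteq> []"
  shows "vpath X F (p @ [x]) \<longleftrightarrow> vpath X F p \<and> (last p, x) \<in> F \<and> x \<in> X"
  using assms
proof (induction p rule: induct_list012)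
  case (3 v w p)
  then show ?case by (auto simp: vpath_Cons2)
qed (auto simp: vpath_Cons2 vpath_single)

text \<open>The vertices before \<open>x\<close> have higher level than \<open>x\<close>, so the
  path stays in V_+.\<close>

lemma reach_path:
  assumes "reach b k x" "x \<in> VP"
  shows "\<exists>p. vpath VP E (p @ [x]) \<and> length p = k \<and> hd p = b"
proof -
  have "\<exists>p. vpath VP E (p @ [x]) \<and> length p = k \<and> hd (p @ [x]) = b" if "(b, x) \<in> E ^^ k" for k
    using that assms(2)
  proof (induction k arbitrary: x)
    case 0
    then show ?case by (intro exI[of _ "[]"]) (simp add: vpath_single)
  next
    case (Suc k)
    then obtain y where y: "(b, y) \<in> E ^^ k" "(y, x) \<in> E" by auto
    then have "y \<in> VP" using lvl_edge edge_in_V by (auto intro: lvl_pos_Vplus)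
    from Suc.IH[OF y(1) this] obtain p where p: "vpath VP E (p @ [y])" "length p = k" "hd (p @ [y]) = b"
      by blast
    then show ?case
      using y Suc.prems by (intro exI[of _ "p @ [y]"]) (auto simp: vpath_snoc hd_append simp del: append_assoc)
  qed
  from this[of k] assms(1) obtain p where "vpath VP E (p @ [x])" "length p = k" "hd (p @ [x]) = b"
    by (auto simp: reach_def)
  moreover then have "p \<noteq> []" using assms(1) by (auto simp: reach_def)
  ultimately show ?thesis by (intro exI[of _ p]) auto
qed

abbreviation Jgr :: "('v list \<Rightarrow> 'k::field) set" where "Jgr \<equiv> Rgr V E star"

lemma Rgr_gen:
  "vpath VP E p \<Longrightarrow> vpath VP E q \<Longrightarrow> length p = length q \<Longrightarrow> hd p = hd q \<Longrightarrow> tmon p - tmon q \<in> Jgr"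
  unfolding Rgr_def by (rule ideal_gen.gen) (auto simp: Rgr_gens_def t_arith)

lemma Rgr_context:
  assumes "tmon p - tmon q \<in> (Jgr :: ('v list \<Rightarrow> 'k::field) set)" "set u \<subseteq> VP" "set v \<subseteq> VP"
  shows "tmon (u @ p @ v) - tmon (u @ q @ v) \<in> (Jgr :: ('v list \<Rightarrow> 'k) set)"
proof -
  have "tmul (tmul (tmon u) (tmon p - tmon q)) (tmon v) \<in> (Jgr :: ('v list \<Rightarrow> 'k) set)"
    using assms unfolding Rgr_def by (intro ideal_gen.mult Tc_tmon)
  then show ?thesis by (simp add: tmul_diff_left tmul_diff_right tmul_tmon)
qed

lemma Rgr_trans:
  assumes "f - g \<in> Jgr" "g - h \<in> Jgr"
  shows "f - h \<in> Jgr"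
  using ideal_gen_add[OF assms[unfolded Rgr_def]] by (simp add: Rgr_def)

text \<open>The bound \<open>k \<le> lvl b\<close> keeps the chosen path of a block inside
  V_+.\<close>

definition valid :: "('v \<times> nat) list \<Rightarrow> bool" where
  "valid n \<longleftrightarrow> (\<forall>(b, k)\<in>set n. b \<in> VP \<and> 0 < k \<and> k \<le> lvl b)"

lemma valid_word_of: "valid n \<Longrightarrow> set (word_of n) \<subseteq> VP"
proof (induction n)
  case (Cons p n)
  then have "vpath VP E (chosen_path (fst p) (snd p))"
    by (intro vpath_chosen_path) (auto simp: valid_def)
  then show ?case using Cons by (auto simp: valid_def vpath_def)
qed simp

lemma valid_extend: "valid n \<Longrightarrow> x \<in> VP \<Longrightarrow> valid (extend n x)"
  using lvl_Vplus[of x] by (auto simp: valid_def extend_def follows_def dest!: lvl_reach)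

text \<open>The chosen path of the block need not lead to \<open>x\<close>. It is first exchanged
  for a path \<open>p\<close> that does, and then \<open>p @ [x]\<close> for the chosen path with
  one more vertex.\<close>

lemma word_of_extend:
  assumes "valid n" "x \<in> VP"
  shows "tmon (word_of n @ [x]) - tmon (word_of (extend n x)) \<in> (Jgr :: ('v list \<Rightarrow> 'k::field) set)"
proof (cases "follows n x")
  case False
  then show ?thesis by (simp add: extend_def Rgr_def)
next
  case True
  then obtain b k m where n: "n = (b, k) # m" and r: "reach b k x" by (auto simp: follows_def)
  obtain p where p: "vpath VP E (p @ [x])" "length p = k" "hd p = b"
    using reach_path[OF r assms(2)] by blast
  have k: "0 < k" "b \<in> VP" "Suc k \<le> lvl b" "set (word_of m) \<subseteq> VP"
    using assms valid_word_of[of m] lvl_reach[OF r] lvl_Vplus[OF assms(2)] by (auto simp: n valid_def)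
  then have "p \<noteq> []" using p by auto
  then have "vpath VP E p" using p by (simp add: vpath_snoc)
  then have "tmon (chosen_path b k) - tmon p \<in> (Jgr :: ('v list \<Rightarrow> 'k) set)"
    using k p by (intro Rgr_gen) (auto simp: vpath_chosen_path hd_chosen_path)
  from Rgr_context[OF this k(4), of "[x]"]
  have 1: "tmon (word_of m @ chosen_path b k @ [x]) - tmon (word_of m @ p @ [x]) \<in> (Jgr :: ('v list \<Rightarrow> 'k) set)"
    using assms(2) by simp
  have "tmon (p @ [x]) - tmon (chosen_path b (Suc k)) \<in> (Jgr :: ('v list \<Rightarrow> 'k) set)"
    using k p \<open>p \<noteq> []\<close> by (intro Rgr_gen) (auto simp: vpath_chosen_path hd_chosen_path simp del: chosen_path.simps)
  from Rgr_context[OF this k(4), of "[]"]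
  have 2: "tmon (word_of m @ p @ [x]) - tmon (word_of m @ chosen_path b (Suc k)) \<in> (Jgr :: ('v list \<Rightarrow> 'k) set)"
    by (simp del: chosen_path.simps)
  show ?thesis
    using Rgr_trans[OF 1 2] True by (simp add: extend_def n del: chosen_path.simps)
qed

abbreviation normal_form :: "'v list \<Rightarrow> ('v \<times> nat) list" where
  "normal_form \<equiv> foldl extend []"

lemma tmon_normal_form:
  assumes "set w \<subseteq> VP"
  shows "valid (normal_form w) \<and> tmon w - tmon (word_of (normal_form w)) \<in> (Jgr :: ('v list \<Rightarrow> 'k::field) set)"
  using assms
proof (induction w rule: rev_induct)
  case Nil
  then show ?case by (simp add: valid_def Rgr_def)
next
  case (snoc x w)
  let ?n = "normal_form w"
  have IH: "valid ?n" "tmon w - tmon (word_of ?n) \<in> (Jgr :: ('v list \<Rightarrow> 'k) set)" and x: "x \<in> VP"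
    using snoc by auto
  have "tmon (w @ [x]) - tmon (word_of ?n @ [x]) \<in> (Jgr :: ('v list \<Rightarrow> 'k) set)"
    using Rgr_context[OF IH(2), of "[]" "[x]"] x by simp
  then show ?case
    using Rgr_trans[OF _ word_of_extend[OF IH(1) x]] valid_extend[OF IH(1) x] by simp
qed

section \<open>Leading forms of elements of \<open>RV\<close>\<close>

definition hcomp :: "nat \<Rightarrow> ('v list \<Rightarrow> 'k::field) \<Rightarrow> 'v list \<Rightarrow> 'k" where
  "hcomp d x = (\<lambda>w. if wdeg lvl w = d then x w else 0)"

text \<open>Since \<open>x\<close> acts by zero on the empty state, the coefficients of its top
  words with a given normal form sum to 0. Hence replacing every top word by the word of its normal
  form turns \<open>hcomp d x\<close> into 0, and each replacement is a change by an element of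
  \<open>Rgr\<close>.\<close>

lemma RV_top_component:
  assumes "x \<in> RV V E star" "x \<in> Tle V lvl star d"
  shows "hcomp d x \<in> Rgr V E star"
proof -
  have fin: "finite {w. x w \<noteq> 0}" and supp: "\<And>w. x w \<noteq> 0 \<Longrightarrow> set w \<subseteq> VP \<and> wdeg lvl w \<le> d"
    and Tc: "x \<in> Tc VP"
    using assms(2) by (auto simp: Tle_def Tc_def)
  let ?W = "{w. x w \<noteq> 0 \<and> wdeg lvl w = d}"
  have finW: "finite ?W" using fin by (rule rev_finite_subset) auto
  have hc: "hcomp d x = (\<Sum>w\<in>?W. tsmul (x w) (tmon w))"
  proof
    fix v
    have "(\<Sum>w\<in>?W. tsmul (x w) (tmon w)) v = (\<Sum>w\<in>?W. if v = w then x w else 0)"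
      unfolding sum_fun_apply by (intro sum.cong refl) (auto simp: tmon_def fun_ops)
    then show "hcomp d x v = (\<Sum>w\<in>?W. tsmul (x w) (tmon w)) v"
      using finW by (auto simp: hcomp_def)
  qed
  have coeff: "(\<Sum>w\<in>{w\<in>?W. normal_form w = s}. x w) = 0" if "s \<in> normal_form ` ?W" for s
  proof -
    have s: "sdeg s = d" using that by (auto simp: sdeg_extends)
    \<comment> \<open>The indicator of \<open>s\<close> vanishes below degree \<open>d\<close>, so
      \<open>wact_leading\<close> turns the action into a test for normal form
      \<open>s\<close>.\<close>
    define \<delta> :: "('v \<times> nat) list \<Rightarrow> 'a" where "\<delta> n = (if n = s then 1 else 0)" for n
    have "vanishes_below d \<delta>" using s by (auto simp: vanishes_below_def \<delta>_def)
    then have lead: "wact w \<delta> [] = \<delta> (normal_form w)" if "x w \<noteq> 0" for w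
      using supp[OF that] by (intro wact_leading) auto
    have "0 = tact x \<delta> []" by (simp add: RV_tact_zero[OF assms(1)] fun_ops)
    also have "\<dots> = (\<Sum>w | x w \<noteq> 0. x w * \<delta> (normal_form w))"
      unfolding tact_def sum_fun_apply using lead by (intro sum.cong refl) (simp add: fun_ops)
    \<comment> \<open>Words of degree below \<open>d\<close> drop out, as normal forms preserve the
      degree.\<close>
    also have "\<dots> = (\<Sum>w\<in>{w\<in>?W. normal_form w = s}. x w)"
      using fin s by (intro sum.mono_neutral_cong_right) (auto simp: \<delta>_def sdeg_extends)
    finally show ?thesis ..
  qed
  have "(\<Sum>w\<in>?W. tsmul (x w) (tmon (word_of (normal_form w)))) = 0"
  proof
    fix v
    have "(\<Sum>w\<in>?W. tsmul (x w) (tmon (word_of (normal_form w)))) v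
      = (\<Sum>w\<in>?W. x w * tmon (word_of (normal_form w)) v)"
      by (simp add: sum_fun_apply fun_ops)
    also have "\<dots> = (\<Sum>s\<in>normal_form ` ?W. \<Sum>w\<in>{w\<in>?W. normal_form w = s}. x w * tmon (word_of (normal_form w)) v)"
      by (rule sum.image_gen[OF finW])
    also have "\<dots> = (\<Sum>s\<in>normal_form ` ?W. (\<Sum>w\<in>{w\<in>?W. normal_form w = s}. x w) * tmon (word_of s) v)"
      unfolding sum_distrib_right by (intro sum.cong refl) auto
    also have "\<dots> = 0" using coeff by (intro sum.neutral) auto
    finally show "(\<Sum>w\<in>?W. tsmul (x w) (tmon (word_of (normal_form w)))) v = 0 v" by (simp add: fun_ops)
  qed
  then have "hcomp d x = (\<Sum>w\<in>?W. tsmul (x w) (tmon w - tmon (word_of (normal_form w))))"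
    unfolding hc by (simp add: fun_eq_iff sum_fun_apply fun_ops right_diff_distrib sum_subtractf)
  moreover have "\<dots> \<in> Rgr V E star"
    using supp tmon_normal_form unfolding Rgr_def
    by (intro ideal_gen_sum ideal_gen_tsmul) blast
  ultimately show ?thesis by simp
qed

section \<open>The degree filtration of the free algebra\<close>

abbreviation TL :: "nat \<Rightarrow> ('v list \<Rightarrow> 'k::field) set" where "TL \<equiv> Tle V lvl star"
abbreviation TS :: "nat \<Rightarrow> ('v list \<Rightarrow> 'k::field) set" where "TS \<equiv> Tlt V lvl star"

lemma TL_Tc: "x \<in> TL d \<Longrightarrow> x \<in> Tc VP" and TS_Tc: "x \<in> TS d \<Longrightarrow> x \<in> Tc VP"
  by (auto simp: Tle_def Tlt_def)

lemma TS_TL: "x \<in> TS d \<Longrightarrow> x \<in> TL d"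
  by (auto simp: Tle_def Tlt_def intro: less_imp_le)

lemma TL_TS: "x \<in> TL d \<Longrightarrow> d < e \<Longrightarrow> x \<in> TS e"
  by (auto simp: Tle_def Tlt_def intro: le_less_trans)

lemma zero_TL [simp]: "0 \<in> TL d" "0 \<in> TS d"
  by (auto simp: Tle_def Tlt_def fun_ops)

lemma TL_add: "x \<in> TL d \<Longrightarrow> y \<in> TL d \<Longrightarrow> x + y \<in> TL d"
  unfolding Tle_def using Tc_add[of x VP y] by (auto simp: fun_ops) (metis add_0)

lemma TS_add: "x \<in> TS d \<Longrightarrow> y \<in> TS d \<Longrightarrow> x + y \<in> TS d"
  unfolding Tlt_def using Tc_add[of x VP y] by (auto simp: fun_ops) (metis add_0)

lemma TL_tsmul: "x \<in> TL d \<Longrightarrow> tsmul c x \<in> TL d"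
  using Tc_tsmul[of x VP c] by (auto simp: Tle_def fun_ops)

lemma TS_tsmul: "x \<in> TS d \<Longrightarrow> tsmul c x \<in> TS d"
  using Tc_tsmul[of x VP c] by (auto simp: Tlt_def fun_ops)

lemma tsmul_minus_one: "tsmul (-1) x = - x"
  by (auto simp: fun_eq_iff fun_ops)

lemma TS_diff: "x \<in> TS d \<Longrightarrow> y \<in> TS d \<Longrightarrow> x - y \<in> TS d"
  using TS_add[of x d "- y"] TS_tsmul[of y d "-1"] by (simp add: tsmul_minus_one)

lemma TL_diff: "x \<in> TL d \<Longrightarrow> y \<in> TL d \<Longrightarrow> x - y \<in> TL d"
  using TL_add[of x d "- y"] TL_tsmul[of y d "-1"] by (simp add: tsmul_minus_one)

lemma TL_sum: "(\<And>i. i \<in> I \<Longrightarrow> F i \<in> TL d) \<Longrightarrow> (\<Sum>i\<in>I. F i) \<in> TL d"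
  by (induction I rule: infinite_finite_induct) (auto intro: TL_add)

lemma TL_tmul:
  assumes "x \<in> TL d" "y \<in> TL e"
  shows "tmul x y \<in> TL (d + e)"
proof -
  have "wdeg lvl w \<le> d + e" if "tmul x y w \<noteq> 0" for w
    using that assms by (elim tmul_nonzeroE) (auto simp: Tle_def intro!: add_mono)
  then show ?thesis using assms by (simp add: Tle_def Tc_tmul)
qed

lemma TS_TL_tmul:
  assumes "x \<in> TS d" "y \<in> TL e"
  shows "tmul x y \<in> TS (d + e)"
proof -
  have "wdeg lvl w < d + e" if "tmul x y w \<noteq> 0" for w
    using that assms by (elim tmul_nonzeroE) (auto simp: Tle_def Tlt_def intro!: add_less_le_mono)
  then show ?thesis using assms by (simp add: Tle_def Tlt_def Tc_tmul)
qed

lemma TL_TS_tmul: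
  assumes "x \<in> TL d" "y \<in> TS e"
  shows "tmul x y \<in> TS (d + e)"
proof -
  have "wdeg lvl w < d + e" if "tmul x y w \<noteq> 0" for w
    using that assms by (elim tmul_nonzeroE) (auto simp: Tle_def Tlt_def intro!: add_le_less_mono)
  then show ?thesis using assms by (simp add: Tle_def Tlt_def Tc_tmul)
qed

lemma TL_tmon: "set w \<subseteq> VP \<Longrightarrow> wdeg lvl w \<le> d \<Longrightarrow> tmon w \<in> TL d"
  using Tc_tmon[of w VP] by (auto simp: Tle_def tmon_def)

section \<open>Leading forms of the symmetric functions of paths\<close>

lemma lvl_path: "vpath X E p \<Longrightarrow> lvl (hd p) + 1 = lvl (last p) + length p"
proof (induction p rule: induct_list012)
  case (3 v w p)
  then show ?case using lvl_edge[of v w] by (auto simp: vpath_Cons2)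
qed (auto simp: vpath_def)

lemma wdeg_path: "vpath X E p \<Longrightarrow> wdeg lvl p = bdeg (lvl (hd p)) (length p)"
proof (induction p rule: induct_list012)
  case (3 v w p)
  then show ?case using lvl_edge[of v w] by (simp add: vpath_Cons2 bdeg_Suc_shift del: bdeg_simps)
qed (auto simp: vpath_def)

lemma vpath_take:
  assumes "vpath X F p" "0 < i"
  shows "vpath X F (take i p)"
  using assms set_take_subset[of i p] by (auto simp: vpath_def)

text \<open>Splitting off the first edge gives e(v, i) = e(w, i) + (v - w) e(w, i - 1), where only v
  e(w, i - 1) reaches the full degree.\<close>

lemma esym_path_leading:
  assumes "vpath V E p" "last p = star" "i \<le> lvl (hd p)"
  shows "esym (eimgs p) i - tmon (take i p) \<in> (TS (bdeg (lvl (hd p)) i) :: ('v list \<Rightarrow> 'k::field) set)"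
  using assms
proof (induction p arbitrary: i rule: induct_list012)
  case 1
  then show ?case by (simp add: vpath_def)
next
  case (2 v)
  then show ?case by (simp add: tmon_Nil)
next
  case (3 v w p)
  let ?e = "\<lambda>i. esym (eimgs (w # p)) i :: 'v list \<Rightarrow> 'k"
  have vw: "(v, w) \<in> E" "v \<in> V" "w \<in> V" and p: "vpath V E (w # p)"
    using "3.prems" edge_in_V by (auto simp: vpath_Cons2)
  have L: "lvl v = Suc (lvl w)" using lvl_edge[OF vw(1)] .
  have len: "length p = lvl w" using lvl_path[OF p] "3.prems" by simp
  have lead: "?e i - tmon (take i (w # p)) \<in> TS (bdeg (lvl w) i)" if "i \<le> lvl w" for i
    using "3.IH"(2)[OF p] that "3.prems" by simp
  have mon: "tmon (take i (w # p)) \<in> (TL (bdeg (lvl w) i) :: ('v list \<Rightarrow> 'k) set)" if "i \<le> lvl w" for i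
  proof (cases "i = 0")
    case False
    then have q: "vpath V E (take i (w # p))" using p by (intro vpath_take) auto
    \<comment> \<open>Levels drop by one per step, so \<open>star\<close> cannot be among the first
      \<open>i \<le> lvl w\<close> vertices.\<close>
    have "star \<notin> set (take i (w # p))"
    proof
      assume "star \<in> set (take i (w # p))"
      then obtain l where l: "l < i" "l < Suc (length p)" "(w # p) ! l = star"
        by (auto simp: in_set_conv_nth)
      have "vpath V E (take (Suc l) (w # p))" using p by (intro vpath_take) auto
      moreover have "last (take (Suc l) (w # p)) = (w # p) ! l"
        using l by (subst take_Suc_conv_app_nth) auto
      ultimately show False
        using lvl_path[of V "take (Suc l) (w # p)"] l that len by simp
    qed
    then have "set (take i (w # p)) \<subseteq> VP" using q by (auto simp: vpath_def Vplus_def)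
    moreover have "wdeg lvl (take i (w # p)) = bdeg (lvl w) i"
      using wdeg_path[OF q] False that len by (simp add: hd_take)
    ultimately show ?thesis by (intro TL_tmon) auto
  qed (auto intro: TL_tmon)
  have le: "?e i \<in> TL (bdeg (lvl w) i)" if "i \<le> lvl w" for i
    using TL_add[OF TS_TL[OF lead[OF that]] mon[OF that]] by simp
  show ?case
  proof (cases i)
    case 0
    then show ?thesis by (simp add: tmon_Nil)
  next
    case (Suc i')
    let ?d = "bdeg (lvl v) i"
    have i': "i' \<le> lvl w" using "3.prems" Suc L by simp
    have d: "?d = lvl v + bdeg (lvl w) i'" using bdeg_Suc_shift by (simp add: L Suc)
    have v: "vimg star v = tmon [v]" "v \<in> VP"
      using L vw by (auto simp: vimg_def Vplus_def)
    have w: "(vimg star w :: 'v list \<Rightarrow> 'k) \<in> TL (lvl w)"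
      using vw by (auto simp: vimg_def t_arith Vplus_def intro!: TL_tmon)
    \<comment> \<open>The degree is smaller because the path starts one level lower; for
      \<open>i\<close> beyond \<open>lvl w\<close> there are too few edges and the term is
      0.\<close>
    have 1: "?e i \<in> TS ?d"
    proof (cases "i \<le> lvl w")
      case True
      then show ?thesis using TL_TS[OF le[OF True]] bdeg_strict_mono[of i "lvl w"] Suc L by simp
    next
      case False
      then have "?e i = 0" by (intro esym_eq_0) (simp add: len)
      then show ?thesis by simp
    qed
    have 2: "tmul (tmon [v]) (?e i' - tmon (take i' (w # p))) \<in> TS ?d"
      unfolding d using v by (intro TL_TS_tmul lead[OF i'] TL_tmon) auto
    \<comment> \<open>One degree is lost since \<open>w\<close> lies one level below
      \<open>v\<close>.\<close>
    have 3: "tmul (vimg star w) (?e i') \<in> TS ?d"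
      by (rule TL_TS[OF TL_tmul[OF w le[OF i']]]) (use d L in linarith)
    have "esym (eimgs (v # w # p)) i - tmon (take i (v # w # p)) =
        ?e i + tmul (tmon [v]) (?e i' - tmon (take i' (w # p))) - tmul (vimg star w) (?e i')"
      by (simp add: Suc eimg_def t_arith v(1) tmul_diff_left tmul_diff_right tmul_tmon algebra_simps)
    then show ?thesis unfolding list.sel(1) using TS_diff[OF TS_add[OF 1 2] 3] by (simp only:)
  qed
qed

lemma path_to_star: "v \<in> V \<Longrightarrow> \<exists>r. vpath V E (v # r) \<and> last (v # r) = star"
proof (induction "lvl v" arbitrary: v)
  case 0
  then have "v = star" using lvl_Vplus[of v] by (auto simp: Vplus_def)
  then show ?case using star_in_V by (intro exI[of _ "[]"]) (simp add: vpath_single)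
next
  case (Suc n)
  then have "v \<in> VP" by (intro lvl_pos_Vplus) auto
  then obtain w where w: "(v, w) \<in> E" using edge_from_Vplus by blast
  then have "n = lvl w" "w \<in> V" using lvl_edge[OF w] Suc edge_in_V by auto
  from Suc.hyps(1)[OF this] obtain r where "vpath V E (w # r)" "last (w # r) = star" by blast
  then show ?case using w Suc.prems by (intro exI[of _ "w # r"]) (simp add: vpath_Cons2)
qed

lemma path_extends_to_star:
  assumes "vpath VP E p"
  shows "\<exists>q. vpath V E q \<and> last q = star \<and> take (length p) q = p"
  using assms
proof (induction p rule: induct_list012)
  case (2 v)
  then obtain r where "vpath V E (v # r)" "last (v # r) = star"
    using path_to_star[of v] by (auto simp: vpath_single Vplus_def)
  then show ?case by (intro exI[of _ "v # r"]) simp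
next
  case (3 v w p)
  then obtain q where q: "vpath V E q" "last q = star" "take (length (w # p)) q = w # p"
    by (auto simp: vpath_Cons2)
  then obtain q' where "q = w # q'" by (cases q) auto
  then show ?case using q "3.prems" by (intro exI[of _ "v # q"]) (auto simp: vpath_Cons2 Vplus_def)
qed (simp add: vpath_def)

lemma RV_esym_diff:
  assumes "vpath V E p" "vpath V E q" "length p = length q" "hd p = hd q" "last p = last q" "i < length p"
  shows "esym (eimgs p) i - esym (eimgs q) i \<in> (RV V E star :: ('v list \<Rightarrow> 'k::field) set)"
proof -
  let ?j = "length p - 1 - i"
  have c: "coefs (eimgs r) ?j = tsmul ((-1) ^ i) (esym (eimgs r) i :: 'v list \<Rightarrow> 'k)"
    if "length r = length p" for r
  proof -
    have "?j \<le> length r - 1" "length r - 1 - ?j = i" using assms(6) that by auto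
    then show ?thesis by (simp only: coefs_eimgs if_True)
  qed
  have "coefs (eimgs p) ?j - coefs (eimgs q) ?j \<in> (RV V E star :: ('v list \<Rightarrow> 'k) set)"
    unfolding RV_def by (rule ideal_gen.gen) (use assms in \<open>auto simp: RV_gens_def eimgs_def t_arith\<close>)
  \<comment> \<open>The sign is its own inverse, so a second multiplication by it clears both
    terms.\<close>
  then have "tsmul ((-1) ^ i) (tsmul ((-1) ^ i) (esym (eimgs p) i) - tsmul ((-1) ^ i) (esym (eimgs q) i))
      \<in> (RV V E star :: ('v list \<Rightarrow> 'k) set)"
    unfolding RV_def using ideal_gen_tsmul assms(3) c by metis
  moreover have "tsmul ((-1) ^ i) (tsmul ((-1) ^ i) x - tsmul ((-1) ^ i) y) = x - y"
    for x y :: "'v list \<Rightarrow> 'k"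
    by (auto simp: fun_eq_iff fun_ops right_diff_distrib mult.assoc[symmetric] power_add[symmetric])
  ultimately show ?thesis by metis
qed

text \<open>By \<open>grcls_eq_iff\<close> below, the elements of \<open>T\<^sub>\<le>\<^sub>d\<close> that vanish in the degree \<open>d\<close> part of \<open>gr A(\<Gamma>)\<close>.\<close>

definition lead_ideal :: "nat \<Rightarrow> ('v list \<Rightarrow> 'k::field) set" where
  "lead_ideal d = {x. \<exists>z\<in>TS d. x - z \<in> RV V E star}"

lemma lead_idealI: "x - z \<in> RV V E star \<Longrightarrow> z \<in> TS d \<Longrightarrow> x \<in> lead_ideal d"
  by (auto simp: lead_ideal_def)

lemma TS_lead_ideal: "x \<in> TS d \<Longrightarrow> x \<in> lead_ideal d"
  by (rule lead_idealI[of x x]) (simp_all add: RV_def)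

lemma zero_lead_ideal [simp]: "0 \<in> lead_ideal d"
  by (simp add: TS_lead_ideal)

lemma lead_ideal_add:
  assumes "x \<in> lead_ideal d" "y \<in> lead_ideal d"
  shows "x + y \<in> lead_ideal d"
proof -
  obtain z z' where "z \<in> TS d" "z' \<in> TS d" "x - z \<in> RV V E star" "y - z' \<in> RV V E star"
    using assms by (auto simp: lead_ideal_def)
  then have "z + z' \<in> TS d" "(x - z) + (y - z') \<in> RV V E star"
    by (simp_all only: RV_def ideal_gen_add TS_add)
  moreover have "x + y - (z + z') = (x - z) + (y - z')" by (simp add: algebra_simps)
  ultimately show ?thesis by (metis lead_idealI)
qed

lemma lead_ideal_tsmul:
  assumes "x \<in> lead_ideal d"
  shows "tsmul c x \<in> lead_ideal d"
proof -
  obtain z where "z \<in> TS d" "x - z \<in> RV V E star"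
    using assms by (auto simp: lead_ideal_def)
  moreover have "tsmul c x - tsmul c z = tsmul c (x - z)"
    by (auto simp: fun_eq_iff fun_ops right_diff_distrib)
  ultimately show ?thesis
    by (intro lead_idealI[of _ "tsmul c z"] TS_tsmul) (auto simp: RV_def intro: ideal_gen_tsmul)
qed

lemma lead_ideal_diff: "x \<in> lead_ideal d \<Longrightarrow> y \<in> lead_ideal d \<Longrightarrow> x - y \<in> lead_ideal d"
  using lead_ideal_add[of x d "- y"] lead_ideal_tsmul[of y d "-1"] by (simp add: tsmul_minus_one)

lemma lead_ideal_sum: "(\<And>i. i \<in> I \<Longrightarrow> F i \<in> lead_ideal d) \<Longrightarrow> (\<Sum>i\<in>I. F i) \<in> lead_ideal d"
  by (induction I rule: infinite_finite_induct) (auto intro: lead_ideal_add)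

lemma lead_ideal_tmul_left:
  assumes "a \<in> TL e" "x \<in> lead_ideal d"
  shows "tmul a x \<in> lead_ideal (e + d)"
proof -
  obtain z where z: "z \<in> TS d" "x - z \<in> RV V E star"
    using assms by (auto simp: lead_ideal_def)
  have "tmul a (x - z) \<in> RV V E star"
    using z TL_Tc[OF assms(1)] by (auto simp: RV_def intro: ideal_gen_mult_left)
  then show ?thesis
    using TL_TS_tmul[OF assms(1) z(1)] by (intro lead_idealI[of _ "tmul a z"]) (simp_all add: tmul_diff_right)
qed

lemma lead_ideal_tmul_right:
  assumes "x \<in> lead_ideal d" "a \<in> TL e"
  shows "tmul x a \<in> lead_ideal (d + e)"
proof -
  obtain z where z: "z \<in> TS d" "x - z \<in> RV V E star"
    using assms by (auto simp: lead_ideal_def)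
  have "tmul (x - z) a \<in> RV V E star"
    using z TL_Tc[OF assms(2)] by (auto simp: RV_def intro: ideal_gen_mult_right)
  then show ?thesis
    using TS_TL_tmul[OF z(1) assms(2)] by (intro lead_idealI[of _ "tmul z a"]) (simp_all add: tmul_diff_left)
qed

text \<open>Prolonged to \<open>star\<close>, the two paths have symmetric functions that agree
  modulo \<open>RV\<close> and have leading forms \<open>p\<close> and \<open>q\<close>.\<close>

lemma Rgr_gen_lead_ideal:
  assumes "vpath VP E p" "vpath VP E q" "length p = length q" "hd p = hd q"
  shows "(tmon p - tmon q :: 'v list \<Rightarrow> 'k::field) \<in> lead_ideal (wdeg lvl p)"
proof -
  obtain p' where p': "vpath V E p'" "last p' = star" "take (length p) p' = p"
    using path_extends_to_star[OF assms(1)] by blast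
  obtain q' where q': "vpath V E q'" "last q' = star" "take (length q) q' = q"
    using path_extends_to_star[OF assms(2)] by blast
  have ne: "p \<noteq> []" "q \<noteq> []" "p' \<noteq> []" "q' \<noteq> []" using assms p' q' by (auto simp: vpath_def)
  have hd: "hd p' = hd p" "hd q' = hd p"
    using ne p'(3) q'(3) assms(4) by (metis hd_take length_greater_0_conv)+
  have len: "length p' = Suc (lvl (hd p))" "length q' = Suc (lvl (hd p))"
    using lvl_path[OF p'(1)] lvl_path[OF q'(1)] p' q' hd by auto
  have "last p \<in> VP" using assms(1) ne(1) by (auto simp: vpath_def)
  then have le: "length p \<le> lvl (hd p)"
    using lvl_path[OF assms(1)] lvl_Vplus[of "last p"] by simp
  have deg: "wdeg lvl p = bdeg (lvl (hd p)) (length p)" using wdeg_path[OF assms(1)] .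
  have P: "esym (eimgs p') (length p) - tmon p \<in> (TS (wdeg lvl p) :: ('v list \<Rightarrow> 'k) set)"
    using esym_path_leading[OF p'(1,2), of "length p"] le p'(3) hd deg by simp
  have Q: "esym (eimgs q') (length p) - tmon q \<in> (TS (wdeg lvl p) :: ('v list \<Rightarrow> 'k) set)"
    using esym_path_leading[OF q'(1,2), of "length p"] le q'(3) hd deg assms(3) by simp
  have R: "esym (eimgs p') (length p) - esym (eimgs q') (length p) \<in> (RV V E star :: ('v list \<Rightarrow> 'k) set)"
    using p' q' hd len le by (intro RV_esym_diff) auto
  show ?thesis
    by (rule lead_idealI[OF _ TS_diff[OF Q P]]) (use R in simp)
qed

section \<open>The isomorphism\<close>

lemma hcomp_add: "hcomp d (x + y) = hcomp d x + hcomp d y"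
  by (auto simp: hcomp_def fun_eq_iff fun_ops)

lemma hcomp_zero [simp]: "hcomp d 0 = 0"
  by (auto simp: hcomp_def fun_eq_iff fun_ops)

lemma hcomp_diff: "hcomp d (x - y) = hcomp d x - hcomp d y"
  by (auto simp: hcomp_def fun_eq_iff fun_ops)

lemma hcomp_tsmul: "hcomp d (tsmul c x) = tsmul c (hcomp d x)"
  by (auto simp: hcomp_def fun_eq_iff fun_ops)

lemma hcomp_sum: "hcomp d (\<Sum>i\<in>I. F i) = (\<Sum>i\<in>I. hcomp d (F i))"
  by (induction I rule: infinite_finite_induct) (auto simp: hcomp_add)

lemma hcomp_hcomp: "hcomp d (hcomp e x) = (if d = e then hcomp e x else 0)"
  by (auto simp: hcomp_def fun_eq_iff fun_ops)

lemma hcomp_tmon: "hcomp d (tmon w) = (if wdeg lvl w = d then tmon w else 0)"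
  by (auto simp: hcomp_def tmon_def fun_eq_iff fun_ops)

lemma hcomp_TL: "x \<in> Tc VP \<Longrightarrow> hcomp d x \<in> TL d"
  by (auto simp: hcomp_def Tle_def Tc_def elim: rev_finite_subset split: if_splits)

lemma hcomp_TS: "x \<in> TS d \<Longrightarrow> hcomp d x = 0"
  by (auto simp: hcomp_def Tlt_def fun_eq_iff fun_ops)

lemma hcomp_top: "x \<in> TL d \<Longrightarrow> x - hcomp d x \<in> TS d"
  using Tc_diff[OF TL_Tc TL_Tc[OF hcomp_TL[OF TL_Tc]], of x d x d d]
  by (auto simp: Tlt_def fun_ops) (auto simp: hcomp_def Tle_def le_less split: if_splits)

lemma hcomp_expand:
  assumes "x \<in> Tc VP"
  shows "x = (\<Sum>d\<in>wdeg lvl ` {w. x w \<noteq> 0}. hcomp d x)"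
proof
  fix w
  have "finite {w. x w \<noteq> 0}" using assms by (simp add: Tc_def)
  then show "x w = (\<Sum>d\<in>wdeg lvl ` {w. x w \<noteq> 0}. hcomp d x) w"
    by (auto simp: sum_fun_apply hcomp_def)
qed

lemma hcomp_nonzero: "hcomp d x \<noteq> 0 \<Longrightarrow> d \<in> wdeg lvl ` {w. x w \<noteq> 0}"
  by (auto simp: hcomp_def fun_eq_iff fun_ops split: if_splits)

lemma hcomp_tmul: "hcomp d (tmul x y) = (\<Sum>i\<le>d. tmul (hcomp i x) (hcomp (d - i) y))"
proof
  fix w
  have "(\<Sum>i\<le>d. tmul (hcomp i x) (hcomp (d - i) y)) w =
    (\<Sum>k\<le>length w. \<Sum>i\<le>d. hcomp i x (take k w) * hcomp (d - i) y (drop k w))"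
    unfolding sum_fun_apply tmul_def by (rule sum.swap)
  also have "\<dots> = (\<Sum>k\<le>length w. if wdeg lvl w = d then x (take k w) * y (drop k w) else 0)"
  proof (intro sum.cong refl)
    fix k
    define a b where "a = wdeg lvl (take k w)" and "b = wdeg lvl (drop k w)"
    have w: "wdeg lvl w = a + b"
      by (simp add: a_def b_def flip: wdeg_append)
    \<comment> \<open>For a fixed splitting of the word only the index \<open>i = a\<close>, the
      degree of the prefix, contributes.\<close>
    have "(\<Sum>i\<le>d. hcomp i x (take k w) * hcomp (d - i) y (drop k w)) =
      (\<Sum>i\<le>d. if i = a then (if a + b = d then x (take k w) * y (drop k w) else 0) else 0)"
    proof (intro sum.cong refl)
      fix i assume "i \<in> {..d}"
      then show "hcomp i x (take k w) * hcomp (d - i) y (drop k w) =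
          (if i = a then (if a + b = d then x (take k w) * y (drop k w) else 0) else 0)"
        unfolding hcomp_def a_def[symmetric] b_def[symmetric] by auto
    qed
    then show "(\<Sum>i\<le>d. hcomp i x (take k w) * hcomp (d - i) y (drop k w)) =
        (if wdeg lvl w = d then x (take k w) * y (drop k w) else 0)"
      unfolding w by simp
  qed
  finally show "hcomp d (tmul x y) w = (\<Sum>i\<le>d. tmul (hcomp i x) (hcomp (d - i) y)) w"
    by (simp add: hcomp_def tmul_def)
qed

lemma RV_diff_self: "x - x \<in> RV V E star"
  by (simp add: RV_def)

text \<open>Turns equality of cosets of cosets into membership in \<open>lead_ideal\<close>, so that
  \<open>grcls\<close> need not be unfolded again.\<close>

lemma grcls_eq_iff:
  assumes "x \<in> TL d" "y \<in> TL d"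
  shows "grcls V E lvl star d x = grcls V E lvl star d y \<longleftrightarrow> x - y \<in> lead_ideal d"
proof
  have grcls: "grcls V E lvl star d x = {Acls V E star u | u. u \<in> TL d \<and> u - x \<in> lead_ideal d}"
    for x :: "'v list \<Rightarrow> 'k::field"
    by (auto simp: grcls_def lead_ideal_def t_arith)
  {
    assume eq: "grcls V E lvl star d x = grcls V E lvl star d y"
    have "Acls V E star x \<in> grcls V E lvl star d x"
      using assms by (auto simp: grcls)
    then obtain u where u: "Acls V E star x = Acls V E star u" "u - y \<in> lead_ideal d"
      unfolding eq by (auto simp: grcls)
    have "x \<in> Acls V E star x"
      using TL_Tc[OF assms(1)] RV_diff_self by (simp add: Acls_def t_arith)
    then have "x - u \<in> RV V E star" unfolding u(1) by (simp add: Acls_def t_arith)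
    then have "x - u \<in> lead_ideal d" by (intro lead_idealI[of _ 0]) auto
    from lead_ideal_add[OF this u(2)] show "x - y \<in> lead_ideal d" by simp
  }
  assume xy: "x - y \<in> lead_ideal d"
  have "u - x \<in> lead_ideal d \<longleftrightarrow> u - y \<in> lead_ideal d" for u
    using lead_ideal_add[OF _ xy, of "u - x"] lead_ideal_diff[OF _ xy, of "u - y"] by auto
  then show "grcls V E lvl star d x = grcls V E lvl star d y" by (simp add: grcls)
qed

lemma grrep_class:
  assumes "X \<in> gr_comp V E lvl star d"
  shows "grrep V E lvl star d X \<in> TL d \<and> grcls V E lvl star d (grrep V E lvl star d X) = X"
proof -
  have "\<exists>x. x \<in> TL d \<and> X = grcls V E lvl star d x"
    using assms by (auto simp: gr_comp_def)
  from someI_ex[OF this] show ?thesis unfolding grrep_def by simp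
qed

section \<open>The map to gr A(\<Gamma>) and its compatibility with the operations\<close>

definition to_gr :: "('v list \<Rightarrow> 'k::field) \<Rightarrow> nat \<Rightarrow> ('v list \<Rightarrow> 'k) set set" where
  "to_gr x = (\<lambda>d. grcls V E lvl star d (hcomp d x))"

text \<open>The operations on \<open>grA\<close> use representatives picked by choice, which are
  controlled only modulo \<open>lead_ideal\<close>.\<close>

lemma grrep_to_gr:
  assumes "x \<in> Tc VP"
  shows "grrep V E lvl star d (to_gr x d) \<in> TL d"
    and "grrep V E lvl star d (to_gr x d) - hcomp d x \<in> lead_ideal d"
proof -
  have "to_gr x d \<in> gr_comp V E lvl star d"
    using hcomp_TL[OF assms] by (auto simp: to_gr_def gr_comp_def)
  from grrep_class[OF this]
  show "grrep V E lvl star d (to_gr x d) \<in> TL d"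
    and "grrep V E lvl star d (to_gr x d) - hcomp d x \<in> lead_ideal d"
    using grcls_eq_iff[OF _ hcomp_TL[OF assms]] by (auto simp: to_gr_def)
qed

lemma to_gr_in_grA:
  assumes "x \<in> Tc VP"
  shows "to_gr x \<in> grA V E lvl star"
proof -
  have "{d. to_gr x d \<noteq> grcls V E lvl star d tzero} \<subseteq> wdeg lvl ` {w. x w \<noteq> 0}"
    by (auto simp: to_gr_def t_arith intro!: hcomp_nonzero)
  moreover have "finite (wdeg lvl ` {w. x w \<noteq> 0})" using assms by (simp add: Tc_def)
  ultimately show ?thesis
    using hcomp_TL[OF assms] by (auto simp: grA_def gr_comp_def to_gr_def intro: finite_subset)
qed

lemma to_gr_surj:
  assumes "g \<in> grA V E lvl star"
  shows "\<exists>x\<in>Tc VP. to_gr x = g"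
proof -
  define r where "r d = grrep V E lvl star d (g d)" for d
  have r: "r d \<in> TL d" "grcls V E lvl star d (r d) = g d" for d
    using assms grrep_class[of "g d" d] by (auto simp: grA_def r_def)
  define S where "S = {d. g d \<noteq> grcls V E lvl star d tzero}"
  have fin: "finite S" using assms by (simp add: grA_def S_def)
  \<comment> \<open>Each representative is cut down to its own degree, so that its lower terms do
    not disturb the other components.\<close>
  define x where "x = (\<Sum>d\<in>S. hcomp d (r d))"
  have "x \<in> Tc VP"
    unfolding x_def by (intro Tc_sum TL_Tc[OF hcomp_TL[OF TL_Tc[OF r(1)]]])
  moreover have "to_gr x d = g d" for d
  proof -
    have hc: "hcomp d x = (if d \<in> S then hcomp d (r d) else 0)"
      unfolding x_def hcomp_sum hcomp_hcomp using fin by (simp add: sum.delta cong: if_cong)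
    show ?thesis
    proof (cases "d \<in> S")
      case True
      have "r d - hcomp d (r d) \<in> lead_ideal d" by (intro TS_lead_ideal hcomp_top r(1))
      then have "grcls V E lvl star d (r d) = grcls V E lvl star d (hcomp d (r d))"
        using grcls_eq_iff[OF r(1) hcomp_TL[OF TL_Tc[OF r(1)]]] by blast
      then show ?thesis using True r(2) by (simp add: to_gr_def hc)
    next
      case False
      then show ?thesis by (simp add: to_gr_def hc S_def t_arith)
    qed
  qed
  ultimately show ?thesis by blast
qed

lemma to_gr_add:
  assumes "x \<in> Tc VP" "y \<in> Tc VP"
  shows "to_gr (tadd x y) = gadd V E lvl star (to_gr x) (to_gr y)"
proof
  fix d
  let ?r = "grrep V E lvl star d (to_gr x d)" and ?s = "grrep V E lvl star d (to_gr y d)"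
  have "(?r - hcomp d x) + (?s - hcomp d y) \<in> lead_ideal d"
    using grrep_to_gr assms by (intro lead_ideal_add) auto
  moreover have "(?r - hcomp d x) + (?s - hcomp d y) = (?r + ?s) - hcomp d (x + y)"
    by (simp add: hcomp_add algebra_simps)
  ultimately have "grcls V E lvl star d (?r + ?s) = grcls V E lvl star d (hcomp d (x + y))"
    using grrep_to_gr(1) assms by (subst grcls_eq_iff) (auto intro: TL_add hcomp_TL Tc_add)
  then show "to_gr (tadd x y) d = gadd V E lvl star (to_gr x) (to_gr y) d"
    by (simp add: gadd_def to_gr_def t_arith)
qed

lemma to_gr_tsmul:
  assumes "x \<in> Tc VP"
  shows "to_gr (tsmul c x) = gsmul V E lvl star c (to_gr x)"
proof
  fix d
  let ?r = "grrep V E lvl star d (to_gr x d)"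
  have "tsmul c (?r - hcomp d x) \<in> lead_ideal d"
    using grrep_to_gr(2)[OF assms] by (rule lead_ideal_tsmul)
  moreover have "tsmul c (?r - hcomp d x) = tsmul c ?r - hcomp d (tsmul c x)"
    by (auto simp: hcomp_tsmul fun_eq_iff fun_ops right_diff_distrib)
  ultimately have "grcls V E lvl star d (tsmul c ?r) = grcls V E lvl star d (hcomp d (tsmul c x))"
    using grrep_to_gr(1) assms by (subst grcls_eq_iff) (auto intro: TL_tsmul hcomp_TL Tc_tsmul)
  then show "to_gr (tsmul c x) d = gsmul V E lvl star c (to_gr x) d"
    by (simp add: gsmul_def to_gr_def)
qed

lemma to_gr_tmul:
  assumes "x \<in> Tc VP" "y \<in> Tc VP"
  shows "to_gr (tmul x y) = gmul V E lvl star (to_gr x) (to_gr y)"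
proof
  fix d
  let ?r = "\<lambda>i. grrep V E lvl star i (to_gr x i)" and ?s = "\<lambda>i. grrep V E lvl star i (to_gr y i)"
  have TL: "tmul (?r i) (?s (d - i)) \<in> TL d" if "i \<le> d" for i
    using TL_tmul[OF grrep_to_gr(1)[OF assms(1), of i] grrep_to_gr(1)[OF assms(2), of "d - i"]] that by simp
  have "tmul (?r i) (?s (d - i)) - tmul (hcomp i x) (hcomp (d - i) y) \<in> lead_ideal d" if "i \<le> d" for i
  proof -
    \<comment> \<open>For representatives r, s of components a, b: r s - a b = (r - a) s + a (s -
      b).\<close>
    have "tmul (?r i - hcomp i x) (?s (d - i)) \<in> lead_ideal (i + (d - i))"
      by (intro lead_ideal_tmul_right grrep_to_gr assms)
    moreover have "tmul (hcomp i x) (?s (d - i) - hcomp (d - i) y) \<in> lead_ideal (i + (d - i))"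
      by (intro lead_ideal_tmul_left grrep_to_gr hcomp_TL assms)
    ultimately show ?thesis
      using lead_ideal_add that by (fastforce simp: tmul_diff_left tmul_diff_right)
  qed
  then have "(\<Sum>i\<le>d. tmul (?r i) (?s (d - i))) - hcomp d (tmul x y) \<in> lead_ideal d"
    unfolding hcomp_tmul sum_subtractf[symmetric] by (intro lead_ideal_sum) auto
  then have "grcls V E lvl star d (\<Sum>i\<le>d. tmul (?r i) (?s (d - i))) = grcls V E lvl star d (hcomp d (tmul x y))"
    using TL assms by (subst grcls_eq_iff) (auto intro!: TL_sum hcomp_TL Tc_tmul)
  moreover have "(\<lambda>w. \<Sum>i\<le>d. tmul (?r i) (?s (d - i)) w) = (\<Sum>i\<le>d. tmul (?r i) (?s (d - i)))"
    by (simp add: fun_eq_iff sum_fun_apply)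
  ultimately show "to_gr (tmul x y) d = gmul V E lvl star (to_gr x) (to_gr y) d"
    by (simp add: gmul_def to_gr_def)
qed

lemma to_gr_tone: "to_gr tone = gone V E lvl star"
  by (rule ext) (simp add: to_gr_def gone_def hcomp_tmon[of _ "[]", unfolded tmon_Nil] t_arith)

lemma to_gr_eq_gzero:
  assumes "x \<in> Tc VP"
  shows "to_gr x d = gzero V E lvl star d \<longleftrightarrow> hcomp d x \<in> lead_ideal d"
  using grcls_eq_iff[OF hcomp_TL[OF assms] zero_TL(1)] by (simp add: to_gr_def gzero_def t_arith)

section \<open>The kernel\<close>

lemma Rgr_gens_Tc: "Rgr_gens V E star \<subseteq> Tc VP"
  by (auto simp: Rgr_gens_def t_arith vpath_def intro!: Tc_diff Tc_tmon)

text \<open>The generators are homogeneous. All degrees are treated at once because a component of a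
  product is a sum of products of components of various degrees.\<close>

lemma Rgr_hcomp_lead_ideal:
  assumes "x \<in> Rgr V E star"
  shows "hcomp d x \<in> lead_ideal d"
  using assms unfolding Rgr_def
proof (induction arbitrary: d rule: ideal_gen.induct)
  case zero
  then show ?case by (simp add: t_arith)
next
  case (gen s)
  then obtain p q where pq: "vpath VP E p" "vpath VP E q" "length p = length q" "hd p = hd q"
    and s: "s = tmon p - tmon q"
    by (auto simp: Rgr_gens_def t_arith)
  have "wdeg lvl p = wdeg lvl q" using wdeg_path[OF pq(1)] wdeg_path[OF pq(2)] pq by simp
  then show ?case using Rgr_gen_lead_ideal[OF pq] by (auto simp: s hcomp_diff hcomp_tmon)
next
  case (add x y)
  then show ?case by (simp add: t_arith hcomp_add lead_ideal_add)
next
  case (mult x a b)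
  have "hcomp e (tmul a x) \<in> lead_ideal e" for e
    unfolding hcomp_tmul
  proof (intro lead_ideal_sum)
    fix i assume "i \<in> {..e}"
    then show "tmul (hcomp i a) (hcomp (e - i) x) \<in> lead_ideal e"
      using lead_ideal_tmul_left[OF hcomp_TL[OF mult.hyps(2), of i] mult.IH[of "e - i"]] by simp
  qed
  note ax = this
  show ?case
    unfolding hcomp_tmul[of d "tmul a x"]
  proof (intro lead_ideal_sum)
    fix i assume "i \<in> {..d}"
    then show "tmul (hcomp i (tmul a x)) (hcomp (d - i) b) \<in> lead_ideal d"
      using lead_ideal_tmul_right[OF ax[of i] hcomp_TL[OF mult.hyps(3), of "d - i"]] by simp
  qed
qed

lemma to_gr_kernel: "{x \<in> Tc VP. to_gr x = gzero V E lvl star} = Rgr V E star"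
proof (intro equalityI subsetI)
  fix x :: "'v list \<Rightarrow> 'k::field" assume "x \<in> {x \<in> Tc VP. to_gr x = gzero V E lvl star}"
  then have x: "x \<in> Tc VP" and ker: "hcomp d x \<in> lead_ideal d" for d
    using to_gr_eq_gzero[of x] by auto
  have "hcomp d x \<in> Rgr V E star" for d
  proof -
    obtain z where z: "z \<in> TS d" "hcomp d x - z \<in> RV V E star"
      using ker[of d] by (auto simp: lead_ideal_def)
    \<comment> \<open>As \<open>z\<close> has degree below \<open>d\<close>, this top component is
      \<open>hcomp d x\<close> itself.\<close>
    then have "hcomp d (hcomp d x - z) \<in> Rgr V E star"
      using x by (intro RV_top_component TL_diff hcomp_TL TS_TL)
    then show ?thesis using z by (simp add: hcomp_diff hcomp_hcomp hcomp_TS)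
  qed
  then have "(\<Sum>d\<in>wdeg lvl ` {w. x w \<noteq> 0}. hcomp d x) \<in> Rgr V E star"
    unfolding Rgr_def by (intro ideal_gen_sum)
  then show "x \<in> Rgr V E star" using hcomp_expand[OF x] by simp
next
  fix x :: "'v list \<Rightarrow> 'k::field" assume x: "x \<in> Rgr V E star"
  then have "x \<in> Tc VP" unfolding Rgr_def by (rule ideal_gen_subset_Tc[OF Rgr_gens_Tc])
  moreover from this have "to_gr x = gzero V E lvl star"
    using to_gr_eq_gzero Rgr_hcomp_lead_ideal[OF x] by blast
  ultimately show "x \<in> {x \<in> Tc VP. to_gr x = gzero V E lvl star}" by simp
qed

end

theorem mainTheorem4:
  fixes V :: "'v set" and E :: "('v \<times> 'v) set" and lvl :: "'v \<Rightarrow> nat" and star :: 'v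
  assumes "layered_graph V E lvl star"
  shows "\<exists>\<psi> :: ('v list \<Rightarrow> 'k::field) \<Rightarrow> (nat \<Rightarrow> ('v list \<Rightarrow> 'k) set set).
    (\<forall>x \<in> Tc (Vplus V star). \<psi> x \<in> grA V E lvl star) \<and>
    \<psi> ` Tc (Vplus V star) = grA V E lvl star \<and>
    (\<forall>x \<in> Tc (Vplus V star). \<forall>y \<in> Tc (Vplus V star).
        \<psi> (tadd x y) = gadd V E lvl star (\<psi> x) (\<psi> y) \<and>
        \<psi> (tmul x y) = gmul V E lvl star (\<psi> x) (\<psi> y)) \<and>
    (\<forall>c. \<forall>x \<in> Tc (Vplus V star). \<psi> (tsmul c x) = gsmul V E lvl star c (\<psi> x)) \<and>
    \<psi> tone = gone V E lvl star \<and>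
    (\<forall>d. \<forall>x \<in> Tc (Vplus V star). (\<forall>w. x w \<noteq> 0 \<longrightarrow> wdeg lvl w = d) \<longrightarrow>
        (\<forall>e. e \<noteq> d \<longrightarrow> \<psi> x e = gzero V E lvl star e)) \<and>
    {x \<in> Tc (Vplus V star). \<psi> x = gzero V E lvl star} = Rgr V E star"
proof -
  interpret layered V E lvl star by unfold_locales (rule assms)
  have homogeneous: "to_gr x e = gzero V E lvl star e"
    if "x \<in> Tc VP" "\<forall>w. x w \<noteq> 0 \<longrightarrow> wdeg lvl w = d" "e \<noteq> d" for d e and x :: "'v list \<Rightarrow> 'k"
  proof -
    have "hcomp e x = 0" using that by (auto simp: hcomp_def fun_eq_iff fun_ops)
    then show ?thesis using to_gr_eq_gzero[OF that(1)] by simp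
  qed
  have surj: "to_gr ` (Tc VP :: ('v list \<Rightarrow> 'k) set) = grA V E lvl star"
    using to_gr_in_grA to_gr_surj by (auto simp: image_iff)
  show ?thesis
    by (intro exI[of _ to_gr] conjI ballI allI impI homogeneous surj)
      (simp_all add: to_gr_in_grA to_gr_add to_gr_tmul to_gr_tsmul to_gr_tone to_gr_kernel)
qed

end
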